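(* Let $\rho_0\in\mathcal S(\mathbb C^2)$, and for each $n\ge1$ let $(\rho_k(n))_{k\ge0}$ be the discrete quantum trajectory with alternating unitaries $\mathsf U^+(n),\mathsf U^-(n)$ described in the context. Assume that the observable $\mathsf A$ is non-diagonal in the basis $\{e_0,e_1\}$. Then, as $n\to\infty$, the sequence of functions $t\mapsto\mathbb E[\rho_{\lfloor nt\rfloor}(n)]$ converges in $L^\infty([0,1])$ to the unique solution of the ODE $$\frac{d\phi_t}{dt}=\frac{\mathsf L^+(\phi_t)+\mathsf L^-(\phi_t)}2,\qquad \phi_0=\rho_0 .$$
   Context: Notation. $\mathcal S(\mathbb C^2)$ is the set of density matrices (positive semidefinite Hermitian $2\times2$ matrices of trace one). $\{e_0,e_1\}$ is an orthonormal basis of $\mathbb C^2$ and $\beta=e_0e_0^\dagger$. $\mathbb E_0$ denotes the partial trace over the second factor of $\mathbb C^2\otimes\mathbb C^2$; $\mathbb E$ is ordinary expectation. $[\cdot,\cdot]$ and $\{\cdot,\cdot\}$ are commutator and anticommutator. Observable. $\mathsf A=\lambda_0\mathsf P_0+\lambda_1\mathsf P_1$ is a self-adjoint operator on $\mathbb C^2$ (second factor) with $\lambda_0\ne\lambda_1$ and $\mathsf P_0,\mathsf P_1$ orthogonal rank-one projectors, $\mathsf P_0+\mathsf P_1=\mathsf I$. "Non-diagonal in $\{e_0,e_1\}$" means that $\{e_0,e_1\}$ is not an eigenbasis of $\mathsf A$, equivalently $\langle e_0,\mathsf P_0e_0\rangle\notin\{0,1\}$. Unitaries. $\mathsf H_0$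 is a Hermitian $2\times2$ matrix and $\mathsf C^+,\mathsf C^-\in M_2(\mathbb C)$. For each $n\ge1$, $\mathsf U^\pm(n)=\sum_{i,j=0}^1\mathsf U^\pm_{ij}(n)\otimes e_ie_j^\dagger$ are unitary operators on $\mathbb C^2\otimes\mathbb C^2$ such that, as $n\to\infty$, $$\mathsf U^\pm_{00}(n)=\mathsf I-\tfrac1n\left(\mathrm i\mathsf H_0+\tfrac12\mathsf C^\pm(\mathsf C^\pm)^\dagger\right)+o(\tfrac1n),\qquad\mathsf U^\pm_{10}(n)=\tfrac1{\sqrt n}\mathsf C^\pm+o(\tfrac1n).$$ Set $\mathsf U_k(n)=\mathsf U^+(n)$ for $k$ even and $\mathsf U_k(n)=\mathsf U^-(n)$ for $k$ odd. Discrete trajectory. Start from $\rho_0(n)=\rho_0$. Given $\rho_k=\rho_k(n)$, set $\rho_k^j:=\mathbb E_0[(\mathsf I\otimes\mathsf P_j)\mathsf U_{k+1}(n)(\rho_k\otimes\beta)\mathsf U_{k+1}(n)^\dagger(\mathsf I\otimes\mathsf P_j)]$ for $j=0,1$. Conditionally on the past, $\rho_{k+1}=\rho_k^j/\mathrm{Tr}[\rho_k^j]$ with probability $\mathrm{Tr}[\rho_k^j]$, $j=0,1$. Degenerate cases where one of these probabilities vanishes are discarded (they do not occur for $n$ large). Generators. $\mathsf L^\pm(\rho)=\mathsf C^\pm\rho(\mathsf C^\pm)^\dagger-\mathrm i[\mathsf H_0,\rho]-\frac12\{\mathsf C^\pm(\mathsf C^\pm)^\dagger,\rho\}$. *)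

theory Defs
  imports "HOL-Probability.Probability" "HOL-Library.Landau_Symbols"
begin

text \<open>
  Operators on \<open>\<complex>\<^sup>2\<close> are matrices \<open>complex^2^2\<close>, with the numeral type \<open>2 = {0, 1}\<close> as index set;
  operators on \<open>\<complex>\<^sup>2 \<otimes> \<complex>\<^sup>2\<close> are matrices indexed by pairs, the first component of a pair
  belonging to the first tensor factor.
\<close>

type_synonym op2 = "complex^2^2"
type_synonym op22 = "complex^(2 \<times> 2)^(2 \<times> 2)"

section \<open>Linear algebra over the complex numbers\<close>

definition cinner :: "complex^'n \<Rightarrow> complex^'n \<Rightarrow> complex" where
  "cinner u v = (\<Sum>i\<in>UNIV. cnj (u $ i) * v $ i)"

definition adj :: "complex^'n^'m \<Rightarrow> complex^'m^'n" where
  "adj A = map_matrix cnj (transpose A)"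

definition cscale :: "complex \<Rightarrow> complex^'n^'m \<Rightarrow> complex^'n^'m" where
  "cscale c A = map_matrix ((*) c) A"

text \<open>\<open>outer u v\<close> is the operator \<open>u v\<^sup>\<dagger>\<close>.\<close>
definition outer :: "complex^'m \<Rightarrow> complex^'n \<Rightarrow> complex^'n^'m" where
  "outer u v = (\<chi> i j. u $ i * cnj (v $ j))"

definition hermitian :: "complex^'n^'n \<Rightarrow> bool" where
  "hermitian A \<longleftrightarrow> adj A = A"

definition unitary :: "complex^'n^'n \<Rightarrow> bool" where
  "unitary U \<longleftrightarrow> U ** adj U = mat 1 \<and> adj U ** U = mat 1"

definition density_matrix :: "complex^'n^'n \<Rightarrow> bool" where
  "density_matrix \<rho> \<longleftrightarrow>
     hermitian \<rho> \<and> (\<forall>v. 0 \<le> Re (cinner v (\<rho> *v v))) \<and> trace \<rho> = 1"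

definition orthonormal_basis :: "('n \<Rightarrow> complex^'n) \<Rightarrow> bool" where
  "orthonormal_basis e \<longleftrightarrow> (\<forall>i j. cinner (e i) (e j) = (if i = j then 1 else 0))"

definition eigenbasis :: "complex^'n^'n \<Rightarrow> ('n \<Rightarrow> complex^'n) \<Rightarrow> bool" where
  "eigenbasis A e \<longleftrightarrow> orthonormal_basis e \<and> (\<forall>i. \<exists>c. A *v e i = c *s e i)"

definition rank_one_projector :: "complex^'n^'n \<Rightarrow> bool" where
  "rank_one_projector P \<longleftrightarrow> hermitian P \<and> P ** P = P \<and> rank P = 1"

definition tensor :: "op2 \<Rightarrow> op2 \<Rightarrow> op22" (infixr "\<otimes>\<^sub>o" 75) where
  "A \<otimes>\<^sub>o B = (\<chi> p q. A $ fst p $ fst q * B $ snd p $ snd q)"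

text \<open>The partial trace over the second tensor factor.\<close>
definition partial_trace :: "op22 \<Rightarrow> op2" where
  "partial_trace X = (\<chi> i j. \<Sum>k\<in>UNIV. X $ (i, k) $ (j, k))"

text \<open>The operator on \<open>\<complex>\<^sup>2 \<otimes> \<complex>\<^sup>2\<close> with blocks \<open>B i j\<close> in the basis \<open>e\<close> of the second factor.\<close>
definition from_blocks :: "(2 \<Rightarrow> complex^2) \<Rightarrow> (2 \<Rightarrow> 2 \<Rightarrow> op2) \<Rightarrow> op22" where
  "from_blocks e B = (\<Sum>i\<in>UNIV. \<Sum>j\<in>UNIV. B i j \<otimes>\<^sub>o outer (e i) (e j))"

definition commutator :: "op2 \<Rightarrow> op2 \<Rightarrow> op2" where
  "commutator A B = A ** B - B ** A"

definition anticommutator :: "op2 \<Rightarrow> op2 \<Rightarrow> op2" where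
  "anticommutator A B = A ** B + B ** A"

section \<open>Discrete quantum trajectories\<close>

definition measured :: "op22 \<Rightarrow> op2 \<Rightarrow> (2 \<Rightarrow> op2) \<Rightarrow> op2 \<Rightarrow> 2 \<Rightarrow> op2" where
  "measured U \<beta> P \<rho> j =
     partial_trace ((mat 1 \<otimes>\<^sub>o P j) ** U ** (\<rho> \<otimes>\<^sub>o \<beta>) ** adj U ** (mat 1 \<otimes>\<^sub>o P j))"

text \<open>The trace below is a nonnegative real number whenever \<open>\<rho>\<close> is positive semidefinite.\<close>
definition outcome_prob :: "op22 \<Rightarrow> op2 \<Rightarrow> (2 \<Rightarrow> op2) \<Rightarrow> op2 \<Rightarrow> 2 \<Rightarrow> real" where
  "outcome_prob U \<beta> P \<rho> j = Re (trace (measured U \<beta> P \<rho> j))"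

definition outcome_state :: "op22 \<Rightarrow> op2 \<Rightarrow> (2 \<Rightarrow> op2) \<Rightarrow> op2 \<Rightarrow> 2 \<Rightarrow> op2" where
  "outcome_state U \<beta> P \<rho> j = measured U \<beta> P \<rho> j /\<^sub>R outcome_prob U \<beta> P \<rho> j"

text \<open>The \<open>\<sigma>\<close>-algebra generated by \<open>X 0, \<dots>, X k\<close>.\<close>
definition past :: "'w measure \<Rightarrow> (nat \<Rightarrow> 'w \<Rightarrow> 'a::topological_space) \<Rightarrow> nat \<Rightarrow> 'w measure" where
  "past M X k = sigma (space M) {X i -` S \<inter> space M | i S. i \<le> k \<and> S \<in> sets borel}"

text \<open>
  \<open>U k\<close> is the unitary used in the \<open>k\<close>-th step, \<open>k \<ge> 1\<close>. The last clause says that the conditional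
  law of \<open>X (Suc k)\<close> given the past is the two-point measure which puts mass \<open>outcome_prob \<dots> j\<close> on
  \<open>outcome_state \<dots> j\<close>. Formulating it as a law also covers the case that both outcomes lead to the
  same state, and an outcome of probability zero (whose normalised state is meaningless) does
  not contribute.
\<close>
definition quantum_trajectory ::
  "'w measure \<Rightarrow> (nat \<Rightarrow> op22) \<Rightarrow> op2 \<Rightarrow> (2 \<Rightarrow> op2) \<Rightarrow> op2 \<Rightarrow> (nat \<Rightarrow> 'w \<Rightarrow> op2) \<Rightarrow> bool" where
  "quantum_trajectory M U \<beta> P \<rho>0 X \<longleftrightarrow>
     prob_space M \<and> (\<forall>k. X k \<in> borel_measurable M) \<and> (AE w in M. X 0 w = \<rho>0) \<and>
     (\<forall>k. \<forall>S\<in>sets borel. AE w in M.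
        real_cond_exp M (past M X k) (indicat_real {w \<in> space M. X (Suc k) w \<in> S}) w =
        (\<Sum>j\<in>UNIV. outcome_prob (U (Suc k)) \<beta> P (X k w) j *
                   indicat_real S (outcome_state (U (Suc k)) \<beta> P (X k w) j)))"

section \<open>The limiting equation\<close>

text \<open>The anticommutator involves \<open>C C\<^sup>\<dagger>\<close>, not \<open>C\<^sup>\<dagger> C\<close>.\<close>
definition generator :: "op2 \<Rightarrow> op2 \<Rightarrow> op2 \<Rightarrow> op2" where
  "generator H C \<rho> = C ** \<rho> ** adj C - cscale \<i> (commutator H \<rho>)
     - (1/2) *\<^sub>R anticommutator (C ** adj C) \<rho>"

definition ode_solution ::
  "('a::real_normed_vector \<Rightarrow> 'a) \<Rightarrow> 'a \<Rightarrow> (real \<Rightarrow> 'a) \<Rightarrow> bool" where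
  "ode_solution F x0 \<phi> \<longleftrightarrow> \<phi> 0 = x0 \<and>
     (\<forall>t\<in>{0..1}. (\<phi> has_vector_derivative F (\<phi> t)) (at t within {0..1}))"

text \<open>\<open>L\<^sup>\<infinity>\<close> is taken with respect to Lebesgue measure; \<open>esssup\<close> is \<open>\<infinity>\<close> for non-measurable functions.\<close>
definition converges_Linfty ::
  "(nat \<Rightarrow> real \<Rightarrow> 'a::real_normed_vector) \<Rightarrow> (real \<Rightarrow> 'a) \<Rightarrow> bool" where
  "converges_Linfty f g \<longleftrightarrow>
     (\<lambda>n. esssup (lebesgue_on {0..1}) (\<lambda>t. ereal (norm (f n t - g t)))) \<longlonglongrightarrow> 0"

end

theory Submission
  imports Defs
begin

text \<open>
  The state \<open>\<rho>\<^sub>k\<close> of a quantum trajectory moves randomly, but its mean moves linearly. The normalisation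
  by the outcome probability cancels against that probability when the two outcomes are averaged, so
  \<open>\<rho>\<^sub>k\<^sub>+\<^sub>1\<close> has the conditional mean \<open>E\<^sub>0[U (\<rho>\<^sub>k \<otimes> \<beta>) U\<^sup>\<dagger>]\<close>: since the two projectors add up to the identity,
  this is the partial trace of the state before the measurement. In terms of the first block column of \<open>U\<close>, and by linearity,
  \<open>E \<rho>\<^sub>k\<^sub>+\<^sub>1 = \<Sum>\<^sub>i U\<^sub>i\<^sub>0 (E \<rho>\<^sub>k) U\<^sub>i\<^sub>0\<^sup>\<dagger>\<close> (lemma \<open>expectation_step\<close>). The only delicate point is an outcome of
  probability zero, whose normalised state is meaningless: its unnormalised state is positive
  semidefinite of trace zero, hence zero, because the trace dominates the norm on positive semidefinite
  matrices (\<open>psd_norm_le_trace\<close>). The same inequality bounds all density matrices, so that every mean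
  exists and the means stay in a fixed ball.

  Inserting the asymptotics of \<open>U\<^sub>0\<^sub>0\<close> and \<open>U\<^sub>1\<^sub>0\<close> shows that one step of the mean is
  \<open>x \<mapsto> x + L\<^sup>\<plusminus>(x)/n + o(1/n)\<close>, uniformly on bounded sets (\<open>channel_expansion\<close>). The mean is thus an Euler
  scheme of step \<open>h = 1/n\<close> in which the vector fields \<open>L\<^sup>+\<close> and \<open>L\<^sup>-\<close> alternate. Write
  \<open>L\<^sup>\<plusminus> = F \<plusminus> G\<close> with \<open>F\<close> the average. The contributions of \<open>G\<close> to two consecutive steps cancel up
  to \<open>O(h\<^sup>2)\<close>. Concretely, subtracting from the mean the partial sum \<open>h s\<^sub>k G\<close> of the alternating
  contributions, where \<open>s\<^sub>k \<in> {-1, 0}\<close>, moves every point by \<open>O(h)\<close> only and turns the scheme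
  into an ordinary Euler scheme for \<open>F\<close> with local error \<open>o(h)\<close>. Stability of the Euler scheme for
  linear \<open>F\<close> then gives uniform convergence to the solution of \<open>\<phi>' = F \<phi>\<close>
  (\<open>alternating_euler_scheme_converges\<close>).
\<close>

section \<open>Linear differential equations\<close>

text \<open>
  The solution is the exponential series \<open>\<Sum> t\<^sup>n/n! F\<^sup>n x0\<close>. It is differentiated one coordinate at a
  time, where it is a real power series.
\<close>
lemma linear_ode_solution_exists:
  fixes F :: "'a::euclidean_space \<Rightarrow> 'a"
  assumes F: "linear F"
  obtains \<phi> where "\<phi> 0 = x0" "\<And>t. (\<phi> has_vector_derivative F (\<phi> t)) (at t)"
proof -
  interpret F: bounded_linear F using F by (simp add: linear_conv_bounded_linear)
  obtain K where K: "K > 0" "\<And>x. norm (F x) \<le> norm x * K" using F.pos_bounded by blast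
  define c where "c n = (F ^^ n) x0 /\<^sub>R fact n" for n
  have norm_c: "norm (c n) \<le> norm x0 * K ^ n / fact n" for n
  proof -
    have "norm ((F ^^ n) x0) \<le> norm x0 * K ^ n"
    proof (induction n)
      case (Suc n)
      have "norm ((F ^^ Suc n) x0) \<le> norm ((F ^^ n) x0) * K" using K(2) by simp
      also have "\<dots> \<le> norm x0 * K ^ n * K" using Suc K(1) by (intro mult_right_mono) auto
      finally show ?case by (simp add: mult_ac)
    qed simp
    thus ?thesis by (simp add: c_def divide_simps)
  qed
  have F_c: "F (c n) = real (Suc n) *\<^sub>R c (Suc n)" for n
    by (simp add: c_def F.scaleR divide_simps del: of_nat_Suc)
  have summ: "summable (\<lambda>n. t ^ n *\<^sub>R c n)" for t :: real
  proof (rule summable_comparison_test)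
    have "norm (t ^ n *\<^sub>R c n) \<le> norm x0 * (inverse (fact n) *\<^sub>R (\<bar>t\<bar> * K) ^ n)" for n
    proof -
      have "norm (t ^ n *\<^sub>R c n) = \<bar>t\<bar> ^ n * norm (c n)" by (simp add: power_abs)
      also have "\<dots> \<le> \<bar>t\<bar> ^ n * (norm x0 * K ^ n / fact n)" by (intro mult_left_mono norm_c) auto
      finally show ?thesis by (simp add: power_mult_distrib field_simps)
    qed
    thus "\<exists>N. \<forall>n\<ge>N. norm (t ^ n *\<^sub>R c n) \<le> norm x0 * (inverse (fact n) *\<^sub>R (\<bar>t\<bar> * K) ^ n)" by blast
    show "summable (\<lambda>n. norm x0 * (inverse (fact n) *\<^sub>R (\<bar>t\<bar> * K) ^ n))"
      by (intro summable_mult summable_exp_generic)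
  qed
  define \<phi> where "\<phi> t = (\<Sum>n. t ^ n *\<^sub>R c n)" for t
  have "\<phi> 0 = x0"
    unfolding \<phi>_def by (subst suminf_finite[of "{0}"]) (auto simp: c_def)
  moreover have "(\<phi> has_vector_derivative F (\<phi> t)) (at t)" for t
  proof -
    have deriv: "((\<lambda>s. \<phi> s \<bullet> b) has_real_derivative F (\<phi> t) \<bullet> b) (at t)" for b
    proof -
      have inner_\<phi>: "\<phi> s \<bullet> b = (\<Sum>n. (c n \<bullet> b) * s ^ n)" for s
        using bounded_linear.suminf[OF bounded_linear_inner_left[of b] summ[of s]]
        by (simp add: \<phi>_def mult.commute)
      have "summable (\<lambda>n. (c n \<bullet> b) * s ^ n)" for s
        using bounded_linear.summable[OF bounded_linear_inner_left[of b] summ[of s]]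
        by (simp add: mult.commute)
      hence "((\<lambda>s. \<Sum>n. (c n \<bullet> b) * s ^ n) has_real_derivative
               (\<Sum>n. diffs (\<lambda>n. c n \<bullet> b) n * t ^ n)) (at t)"
        by (rule termdiffs_strong_converges_everywhere)
      moreover have "(\<Sum>n. diffs (\<lambda>n. c n \<bullet> b) n * t ^ n) = F (\<phi> t) \<bullet> b"
      proof -
        have "F (\<phi> t) \<bullet> b = (\<Sum>n. F (t ^ n *\<^sub>R c n)) \<bullet> b"
          unfolding \<phi>_def by (subst F.suminf[OF summ]) simp
        also have "\<dots> = (\<Sum>n. F (t ^ n *\<^sub>R c n) \<bullet> b)"
          by (rule bounded_linear.suminf[OF bounded_linear_inner_left F.summable[OF summ]])
        finally show ?thesis by (simp add: F.scaleR F_c diffs_def mult_ac del: of_nat_Suc)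
      qed
      ultimately show ?thesis by (simp add: inner_\<phi>)
    qed
    show ?thesis
      unfolding has_vector_derivative_def
      by (subst has_derivative_componentwise_within)
         (use deriv[unfolded has_field_derivative_def] in \<open>simp add: mult_commute_abs\<close>)
  qed
  ultimately show ?thesis using that by blast
qed

text \<open>
  Gronwall's argument: for the difference \<open>\<delta>\<close> of two solutions, the weight \<open>exp(-2Kt)\<close> makes
  \<open>exp(-2Kt) \<bar>\<delta>(t)\<bar>\<^sup>2\<close> nonincreasing when \<open>K\<close> bounds \<open>F\<close>, and it starts at zero.
\<close>
lemma linear_ode_solution_unique:
  fixes F :: "'a::euclidean_space \<Rightarrow> 'a"
  assumes F: "linear F" and sol: "ode_solution F x0 \<phi>" "ode_solution F x0 \<psi>" and t: "t \<in> {0..1}"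
  shows "\<psi> t = \<phi> t"
proof -
  interpret F: bounded_linear F using F by (simp add: linear_conv_bounded_linear)
  obtain K where K: "K > 0" "\<And>x. norm (F x) \<le> norm x * K" using F.pos_bounded by blast
  define \<delta> where "\<delta> s = \<psi> s - \<phi> s" for s
  define g where "g s = exp (- 2 * K * s) * (\<delta> s \<bullet> \<delta> s)" for s
  have \<delta>': "(\<delta> has_vector_derivative F (\<delta> s)) (at s within {0..1})" if "s \<in> {0..1}" for s
    using sol that unfolding \<delta>_def ode_solution_def F.diff
    by (intro has_vector_derivative_diff) auto
  have g': "(g has_real_derivative 2 * exp (- 2 * K * s) * (\<delta> s \<bullet> F (\<delta> s) - K * (\<delta> s \<bullet> \<delta> s)))
              (at s within {0..1})" if "s \<in> {0..1}" for s
    unfolding g_def has_field_derivative_def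
    by (rule derivative_eq_intros \<delta>'[OF that, unfolded has_vector_derivative_def] refl)+
       (auto simp: fun_eq_iff algebra_simps inner_commute)
  have neg: "2 * exp (- 2 * K * s) * (\<delta> s \<bullet> F (\<delta> s) - K * (\<delta> s \<bullet> \<delta> s)) \<le> 0" for s
  proof -
    have "\<delta> s \<bullet> F (\<delta> s) \<le> norm (\<delta> s) * norm (F (\<delta> s))" by (rule norm_cauchy_schwarz)
    also have "\<dots> \<le> norm (\<delta> s) * (norm (\<delta> s) * K)" by (intro mult_left_mono K) auto
    also have "\<dots> = K * (\<delta> s \<bullet> \<delta> s)" by (simp add: dot_square_norm power2_eq_square)
    finally show ?thesis by (simp add: mult_nonneg_nonpos)
  qed
  have "\<exists>s\<in>{0..t}. g t - g 0 = (\<lambda>x. x * (2 * exp (- 2 * K * s) * (\<delta> s \<bullet> F (\<delta> s) - K * (\<delta> s \<bullet> \<delta> s)))) (t - 0)"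
  proof (rule mvt_very_simple)
    fix s assume "0 \<le> s" "s \<le> t"
    thus "(g has_derivative (\<lambda>x. x * (2 * exp (- 2 * K * s) * (\<delta> s \<bullet> F (\<delta> s) - K * (\<delta> s \<bullet> \<delta> s))))) (at s within {0..t})"
      using g'[of s] t unfolding has_field_derivative_def
      by (simp add: mult.commute[of _ "_ * (_ - _)"]) (rule has_derivative_subset, auto)
  qed (use t in auto)
  then obtain s where "g t - g 0 = t * (2 * exp (- 2 * K * s) * (\<delta> s \<bullet> F (\<delta> s) - K * (\<delta> s \<bullet> \<delta> s)))"
    by auto
  hence "g t \<le> g 0" using mult_nonneg_nonpos[OF _ neg[of s], of t] t by simp
  hence "\<delta> t \<bullet> \<delta> t \<le> 0" using sol unfolding g_def \<delta>_def ode_solution_def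
    by (simp add: mult_le_0_iff)
  hence "\<delta> t = 0" by (metis inner_eq_zero_iff inner_ge_zero order_antisym)
  thus ?thesis by (simp add: \<delta>_def)
qed

text \<open>
  What the convergence proof needs from the exact solution: the quadratic bound is the local error of
  the Euler step, and the Lipschitz bound controls the rounding of \<open>t\<close> to the grid.
\<close>
lemma linear_ode_solution_bounds:
  fixes F :: "'a::euclidean_space \<Rightarrow> 'a"
  assumes F: "linear F" and sol: "\<And>t. (\<phi> has_vector_derivative F (\<phi> t)) (at t)"
  obtains C where "C \<ge> 0"
    "\<And>s t. s \<in> {0..1} \<Longrightarrow> t \<in> {0..1} \<Longrightarrow> norm (\<phi> t - \<phi> s) \<le> C * \<bar>t - s\<bar>"
    "\<And>s t. s \<in> {0..1} \<Longrightarrow> t \<in> {0..1} \<Longrightarrow> norm (\<phi> t - \<phi> s - (t - s) *\<^sub>R F (\<phi> s)) \<le> C * (t - s)\<^sup>2"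
proof -
  interpret F: bounded_linear F using F by (simp add: linear_conv_bounded_linear)
  obtain K where K: "K > 0" "\<And>x. norm (F x) \<le> norm x * K" using F.pos_bounded by blast
  have sol': "(\<phi> has_vector_derivative F (\<phi> t)) (at t within S)" for t S
    by (rule has_vector_derivative_at_within[OF sol])
  have "continuous_on {0..1} \<phi>"
    by (rule continuous_on_vector_derivative) (rule sol')
  hence "bounded (\<phi> ` {0..1})"
    by (intro compact_imp_bounded compact_continuous_image) auto
  then obtain R where R: "\<And>t. t \<in> {0..1} \<Longrightarrow> norm (\<phi> t) \<le> R"
    unfolding bounded_iff by (meson imageI)
  have R0: "R \<ge> 0" using R[of 0] norm_ge_zero[of "\<phi> 0"] by (simp only: atLeastAtMost_iff) linarith
  have F\<phi>: "norm (F (\<phi> t)) \<le> R * K" if "t \<in> {0..1}" for t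
    using K(2)[of "\<phi> t"] mult_right_mono[OF R[OF that], of K] K(1) by linarith
  have lip: "norm (\<phi> t - \<phi> s) \<le> 3 * R * K * \<bar>t - s\<bar>" if "s \<in> {0..1}" "t \<in> {0..1}" for s t
  proof -
    have "norm (\<phi> t - \<phi> s - (t - s) *\<^sub>R F (\<phi> s)) \<le> norm (t - s) * (2 * R * K)"
    proof (rule vector_differentiable_bound_linearization[where S = "{0..1}"])
      show "norm (F (\<phi> x) - F (\<phi> s)) \<le> 2 * R * K" if "x \<in> {0..1}" for x
        using norm_triangle_ineq4[of "F (\<phi> x)" "F (\<phi> s)"] F\<phi>[OF that] F\<phi>[OF \<open>s \<in> {0..1}\<close>] by linarith
    qed (use that sol' in \<open>auto simp: closed_segment_eq_real_ivl\<close>)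
    moreover have "norm ((t - s) *\<^sub>R F (\<phi> s)) \<le> \<bar>t - s\<bar> * (R * K)"
      using F\<phi>[OF that(1)] by (simp add: mult_left_mono)
    moreover have "norm (\<phi> t - \<phi> s) \<le> norm (\<phi> t - \<phi> s - (t - s) *\<^sub>R F (\<phi> s)) + norm ((t - s) *\<^sub>R F (\<phi> s))"
      using norm_triangle_sub[of "\<phi> t - \<phi> s" "(t - s) *\<^sub>R F (\<phi> s)"] by simp
    ultimately show ?thesis by (simp add: algebra_simps)
  qed
  have quad: "norm (\<phi> t - \<phi> s - (t - s) *\<^sub>R F (\<phi> s)) \<le> 3 * R * K * K * (t - s)\<^sup>2"
    if st: "s \<in> {0..1}" "t \<in> {0..1}" for s t
  proof -
    have sub: "closed_segment s t \<subseteq> {0..1}" using st by (auto simp: closed_segment_eq_real_ivl)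
    have "norm (\<phi> t - \<phi> s - (t - s) *\<^sub>R F (\<phi> s)) \<le> norm (t - s) * (3 * R * K * \<bar>t - s\<bar> * K)"
    proof (rule vector_differentiable_bound_linearization[where S = "closed_segment s t"])
      fix x assume x: "x \<in> closed_segment s t"
      have "norm (F (\<phi> x) - F (\<phi> s)) \<le> norm (\<phi> x - \<phi> s) * K" using K(2) by (simp flip: F.diff)
      also have "\<dots> \<le> 3 * R * K * \<bar>x - s\<bar> * K" using x sub st K(1) by (intro mult_right_mono lip) auto
      also have "\<dots> \<le> 3 * R * K * \<bar>t - s\<bar> * K"
        using x R0 K(1) by (intro mult_right_mono mult_left_mono) (auto simp: closed_segment_eq_real_ivl split: if_splits)
      finally show "norm (F (\<phi> x) - F (\<phi> s)) \<le> 3 * R * K * \<bar>t - s\<bar> * K" .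
    qed (use sol' in auto)
    also have "\<dots> = 3 * R * K * K * (t - s)\<^sup>2" 
      unfolding power2_abs[of "t - s", symmetric] by (simp only: power2_eq_square real_norm_def mult_ac)
    finally show ?thesis .
  qed
  show ?thesis
  proof (rule that[of "3 * R * K + 3 * R * K * K"])
    show "3 * R * K + 3 * R * K * K \<ge> 0" using R0 K(1) by simp
    have "3 * R * K * K \<ge> 0" using R0 K(1) by simp
    note le = mult_right_mono[OF this]
    show "norm (\<phi> t - \<phi> s) \<le> (3 * R * K + 3 * R * K * K) * \<bar>t - s\<bar>" if "s \<in> {0..1}" "t \<in> {0..1}" for s t
      using lip[OF that] le[of "\<bar>t - s\<bar>"] by (simp add: algebra_simps)
    show "norm (\<phi> t - \<phi> s - (t - s) *\<^sub>R F (\<phi> s)) \<le> (3 * R * K + 3 * R * K * K) * (t - s)\<^sup>2"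
      if "s \<in> {0..1}" "t \<in> {0..1}" for s t
      unfolding distrib_right by (rule add_increasing[OF _ quad[OF that]]) (use R0 K(1) in simp)
  qed
qed

section \<open>Euler schemes with alternating vector fields\<close>

text \<open>
  The index parity chooses the vector field, and the first step, from \<open>0\<close> to \<open>1\<close>, uses \<open>Lm\<close>.
  The alternating part \<open>G = (Lp - Lm)/2\<close> enters step \<open>k\<close> with sign \<open>(-1)\<^sup>k\<close>; the signs of the steps \<open>1, ..., k\<close> add
  up to \<open>s k\<close>, which stays bounded. Hence \<open>z k = m n k - h s\<^sub>k G (m n k)\<close> has absorbed the alternation: the
  remainder of its Euler step for \<open>F\<close> contains \<open>G\<close> only applied to an increment of \<open>m n\<close>, of size \<open>O(h)\<close>, or with a
  second factor \<open>h\<close>. A discrete Gronwall argument compares \<open>z\<close> with \<open>\<phi>\<close> on the grid.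
\<close>
lemma alternating_euler_scheme_converges:
  fixes Lp Lm :: "'a::euclidean_space \<Rightarrow> 'a"
  defines "F \<equiv> \<lambda>x. (1/2) *\<^sub>R (Lp x + Lm x)"
  assumes lin: "linear Lp" "linear Lm"
    and sol: "\<And>t. (\<phi> has_vector_derivative F (\<phi> t)) (at t)"
    and init: "\<And>n. n \<ge> 1 \<Longrightarrow> m n 0 = \<phi> 0"
    and step: "\<And>n k. n \<ge> 1 \<Longrightarrow> norm (m n (Suc k) - m n k -
                 (1 / real n) *\<^sub>R (if even (Suc k) then Lp else Lm) (m n k)) \<le> \<epsilon> n / real n"
    and bounded: "\<And>n k. n \<ge> 1 \<Longrightarrow> norm (m n k) \<le> B"
    and \<epsilon>: "\<epsilon> \<longlonglongrightarrow> 0"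
  obtains \<theta> where "\<theta> \<longlonglongrightarrow> 0"
    "\<And>n t. n \<ge> 1 \<Longrightarrow> t \<in> {0..1} \<Longrightarrow> norm (m n (nat \<lfloor>real n * t\<rfloor>) - \<phi> t) \<le> \<theta> n"
proof -
  define G where "G x = (1/2) *\<^sub>R (Lp x - Lm x)" for x
  have lF: "linear F" and lG: "linear G"
    unfolding F_def G_def using lin
    by (auto intro!: linear_compose_scale_right linear_compose_add linear_compose_sub)
  interpret F: bounded_linear F using lF by (simp add: linear_conv_bounded_linear)
  interpret G: bounded_linear G using lG by (simp add: linear_conv_bounded_linear)
  obtain KF where KF: "KF > 0" "\<And>x. norm (F x) \<le> norm x * KF" using F.pos_bounded by blast
  obtain KG where KG: "KG > 0" "\<And>x. norm (G x) \<le> norm x * KG" using G.pos_bounded by blast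
  define K where "K = KF + KG"
  have K0: "K > 0" using KF KG by (simp add: K_def)
  have KF': "norm (F x) \<le> K * norm x" for x
    using KF(2)[of x] KG(1) by (simp add: K_def algebra_simps add_increasing2)
  have KG': "norm (G x) \<le> K * norm x" for x
    using KG(2)[of x] KF(1) by (simp add: K_def algebra_simps add_increasing)
  obtain C where C: "C \<ge> 0"
    "\<And>s t. s \<in> {0..1} \<Longrightarrow> t \<in> {0..1} \<Longrightarrow> norm (\<phi> t - \<phi> s) \<le> C * \<bar>t - s\<bar>"
    "\<And>s t. s \<in> {0..1} \<Longrightarrow> t \<in> {0..1} \<Longrightarrow> norm (\<phi> t - \<phi> s - (t - s) *\<^sub>R F (\<phi> s)) \<le> C * (t - s)\<^sup>2"
    using linear_ode_solution_bounds[OF lF sol] by blast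
  define \<eta> where "\<eta> n = \<epsilon> n + (K * \<epsilon> n + 3 * K\<^sup>2 * B + C) * (1 / real n)" for n
  define \<theta> where "\<theta> n = \<eta> n * exp K + (K * B + C) * (1 / real n)" for n
  have "\<theta> \<longlonglongrightarrow> 0"
    unfolding \<theta>_def \<eta>_def by (rule tendsto_eq_intros \<epsilon> lim_1_over_n refl | simp)+
  moreover have "norm (m n (nat \<lfloor>real n * t\<rfloor>) - \<phi> t) \<le> \<theta> n" if n: "n \<ge> 1" and t: "t \<in> {0..1}" for n t
  proof -
    define h where "h = 1 / real n"
    have h0: "h > 0" and nh: "real n * h = 1" using n by (auto simp: h_def)
    \<comment> \<open>Partial sums of the signs \<open>(-1)\<^sup>1 + ... + (-1)\<^sup>k\<close>.\<close>
    define s where "s k = (if odd k then - 1 else 0 :: real)" for k :: nat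
    have s1: "\<bar>s k\<bar> \<le> 1" for k by (simp add: s_def)
    define z where "z k = m n k - (h * s k) *\<^sub>R G (m n k)" for k
    define r where "r k = z (Suc k) - z k - h *\<^sub>R F (z k)" for k
    have r_bound: "norm (r k) \<le> h * (\<epsilon> n + K * (h * \<epsilon> n) + 3 * K\<^sup>2 * B * h)" for k
    proof -
      define x where "x = m n k"
      define y where "y = m n (Suc k)"
      define d where "d = y - x - h *\<^sub>R (if even (Suc k) then Lp else Lm) x"
      have d: "norm d \<le> h * \<epsilon> n" using step[OF n, of k] by (simp add: d_def x_def y_def h_def)
      have x: "norm x \<le> B" using bounded[OF n] by (simp add: x_def)
      \<comment> \<open>The increment of \<open>s\<close> is the sign of \<open>G\<close> in the step.\<close>
      have L: "(if even (Suc k) then Lp else Lm) x = F x + (s (Suc k) - s k) *\<^sub>R G x"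
        by (auto simp: F_def G_def s_def algebra_simps simp flip: scaleR_add_left)
      have "r k = d - (h * s (Suc k)) *\<^sub>R G (y - x) + (h * h * s k) *\<^sub>R F (G x)"
        unfolding r_def z_def d_def L x_def[symmetric] y_def[symmetric]
        by (simp add: F.diff F.scaleR G.diff G.scaleR algebra_simps)
      moreover have "norm (a - b + c) \<le> norm a + norm b + norm c" for a b c :: 'a by norm
      ultimately have "norm (r k) \<le> norm d + norm ((h * s (Suc k)) *\<^sub>R G (y - x)) + norm ((h * h * s k) *\<^sub>R F (G x))"
        by metis
      moreover have "norm ((h * s (Suc k)) *\<^sub>R G (y - x)) \<le> h * (K * (h * \<epsilon> n + h * (2 * K * B)))"
      proof -
        have "norm (F x + (s (Suc k) - s k) *\<^sub>R G x) \<le> norm (F x) + norm (G x)"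
          by (rule order.trans[OF norm_triangle_ineq]) (auto simp: s_def)
        also have "\<dots> \<le> K * norm x + K * norm x" by (intro add_mono KF' KG')
        also have "\<dots> \<le> 2 * K * B" using x K0 by simp
        finally have "norm (h *\<^sub>R (F x + (s (Suc k) - s k) *\<^sub>R G x)) \<le> h * (2 * K * B)"
          using h0 by simp
        moreover have "y - x = d + h *\<^sub>R (F x + (s (Suc k) - s k) *\<^sub>R G x)" unfolding d_def L by simp
        ultimately have "norm (y - x) \<le> h * \<epsilon> n + h * (2 * K * B)"
          using d norm_triangle_ineq[of d "h *\<^sub>R (F x + (s (Suc k) - s k) *\<^sub>R G x)"] by simp
        hence "norm (G (y - x)) \<le> K * (h * \<epsilon> n + h * (2 * K * B))"
          using KG'[of "y - x"] K0 by (meson mult_left_mono less_imp_le order.trans)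
        moreover have "\<bar>s (Suc k)\<bar> * norm (G (y - x)) \<le> norm (G (y - x))"
          using s1 by (simp add: mult_left_le_one_le)
        ultimately show ?thesis using h0 by (simp add: abs_mult mult.assoc)
      qed
      moreover have "norm ((h * h * s k) *\<^sub>R F (G x)) \<le> h * h * (K * (K * B))"
      proof -
        have "norm (F (G x)) \<le> K * (K * B)"
          using KF'[of "G x"] KG'[of x] x K0 by (meson mult_left_mono less_imp_le order.trans)
        moreover have "\<bar>s k\<bar> * norm (F (G x)) \<le> norm (F (G x))"
          using s1 by (simp add: mult_left_le_one_le)
        ultimately show ?thesis using h0 by (simp add: abs_mult mult.assoc)
      qed
      ultimately show ?thesis using d by (simp add: algebra_simps power2_eq_square)
    qed
    define q where "q = 1 + h * K"
    have q1: "q \<ge> 1" using h0 K0 by (simp add: q_def)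
    have \<eta>_eq: "h * \<eta> n = h * (\<epsilon> n + K * (h * \<epsilon> n) + 3 * K\<^sup>2 * B * h) + C * h\<^sup>2"
      by (simp add: \<eta>_def h_def[symmetric] algebra_simps power2_eq_square)
    have \<eta>0: "h * \<eta> n \<ge> 0"
      unfolding \<eta>_eq using order.trans[OF norm_ge_zero r_bound[of 0]] C(1) by simp
    \<comment> \<open>\<open>q ^ k\<close> accounts for the amplification of the earlier errors; \<open>q ^ n\<close> is at most \<open>exp K\<close>.\<close>
    have err: "k \<le> n \<Longrightarrow> norm (z k - \<phi> (real k * h)) \<le> real k * (h * \<eta> n) * q ^ k" for k
    proof (induction k)
      case 0
      show ?case using init[OF n] by (simp add: z_def s_def)
    next
      case (Suc k)
      define E where "E = z k - \<phi> (real k * h)"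
      have range: "real j * h \<in> {0..1}" if "j \<le> n" for j
        using that h0 nh mult_right_mono[of "real j" "real n" h] by simp
      have "norm (\<phi> (real (Suc k) * h) - \<phi> (real k * h)
              - (real (Suc k) * h - real k * h) *\<^sub>R F (\<phi> (real k * h))) \<le> C * (real (Suc k) * h - real k * h)\<^sup>2"
        using Suc.prems by (intro C(3) range) auto
      moreover have hh: "real (Suc k) * h - real k * h = h" by (simp add: algebra_simps)
      ultimately have c: "norm (\<phi> (real (Suc k) * h) - \<phi> (real k * h) - h *\<^sub>R F (\<phi> (real k * h))) \<le> C * h\<^sup>2"
        by (simp only:)
      have "z (Suc k) - \<phi> (real (Suc k) * h) = E + h *\<^sub>R F E + r k
              - (\<phi> (real (Suc k) * h) - \<phi> (real k * h) - h *\<^sub>R F (\<phi> (real k * h)))"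
        by (simp add: E_def r_def F.diff scaleR_diff_right)
      moreover have "norm (a + b + c - d) \<le> norm a + norm b + norm c + norm d" for a b c d :: 'a by norm
      ultimately have "norm (z (Suc k) - \<phi> (real (Suc k) * h)) \<le> norm E + norm (h *\<^sub>R F E) + norm (r k)
              + norm (\<phi> (real (Suc k) * h) - \<phi> (real k * h) - h *\<^sub>R F (\<phi> (real k * h)))"
        by metis
      also have "\<dots> \<le> norm E + h * (K * norm E) + h * \<eta> n"
      proof -
        have "norm (h *\<^sub>R F E) \<le> h * (K * norm E)" using KF'[of E] h0 by simp
        thus ?thesis using c r_bound[of k] unfolding \<eta>_eq by linarith
      qed
      also have "\<dots> = q * norm E + h * \<eta> n" by (simp add: q_def algebra_simps)
      also have "\<dots> \<le> q * (real k * (h * \<eta> n) * q ^ k) + h * \<eta> n * q ^ Suc k"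
        using Suc q1 \<eta>0 unfolding E_def
        by (intro add_mono mult_left_mono) (auto simp del: power_Suc intro!: mult_le_cancel_left1[THEN iffD2] one_le_power)
      finally show ?case by (simp add: algebra_simps)
    qed
    define k where "k = nat \<lfloor>real n * t\<rfloor>"
    have "real n * t \<le> real n" "0 \<le> real n * t" using t by (auto simp: mult_left_le)
    hence k: "real k \<le> real n * t" "real n * t < real k + 1" and kn: "k \<le> n"
      by (auto simp: k_def) (linarith+)
    have kt: "real k * h \<le> t" "t < real k * h + h" and kh: "real k * h \<in> {0..1}"
      using k kn n by (auto simp: h_def field_simps)
    have "norm (z k - \<phi> (real k * h)) \<le> real k * (h * \<eta> n) * q ^ k" by (rule err[OF kn])
    also have "\<dots> \<le> real n * (h * \<eta> n) * exp K"
    proof (intro mult_mono)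
      have "q ^ k \<le> q ^ n" using q1 kn by (rule power_increasing[rotated])
      also have "\<dots> \<le> exp K" using exp_ge_one_plus_x_over_n_power_n[of n K] n K0 by (simp add: q_def h_def)
      finally show "q ^ k \<le> exp K" .
    qed (use \<eta>0 h0 kn q1 in \<open>auto simp: zero_le_mult_iff\<close>)
    also have "\<dots> = \<eta> n * exp K" using nh by (simp flip: mult.assoc)
    finally have 1: "norm (z k - \<phi> (real k * h)) \<le> \<eta> n * exp K" .
    have 2: "norm ((h * s k) *\<^sub>R G (m n k)) \<le> h * (K * B)"
    proof -
      have "norm (G (m n k)) \<le> K * B"
        using KG'[of "m n k"] bounded[OF n, of k] K0 by (meson mult_left_mono less_imp_le order.trans)
      moreover have "\<bar>s k\<bar> * norm (G (m n k)) \<le> norm (G (m n k))"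
        using s1 by (simp add: mult_left_le_one_le)
      ultimately show ?thesis using h0 by (simp add: abs_mult mult.assoc)
    qed
    have "norm (\<phi> t - \<phi> (real k * h)) \<le> C * \<bar>t - real k * h\<bar>" using t kh by (intro C(2))
    also have "\<dots> \<le> C * h" using kt C(1) by (intro mult_left_mono) auto
    finally have 3: "norm (\<phi> t - \<phi> (real k * h)) \<le> C * h" .
    have "m n k - \<phi> t = (h * s k) *\<^sub>R G (m n k) + (z k - \<phi> (real k * h)) - (\<phi> t - \<phi> (real k * h))"
      by (simp add: z_def)
    moreover have "norm (a + b - c) \<le> norm a + norm b + norm c" for a b c :: 'a by norm
    ultimately have "norm (m n k - \<phi> t) \<le> norm ((h * s k) *\<^sub>R G (m n k)) + norm (z k - \<phi> (real k * h))
             + norm (\<phi> t - \<phi> (real k * h))"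
      by metis
    thus ?thesis using 1 2 3 unfolding \<theta>_def k_def[symmetric] h_def[symmetric] by (simp add: algebra_simps)
  qed
  ultimately show ?thesis using that by blast
qed


section \<open>Complex matrices and positivity\<close>

lemma all_bit: "(\<forall>i::2. Q i) \<longleftrightarrow> Q 0 \<and> Q 1"
proof -
  have "(2::2) = 0" by simp
  thus ?thesis using forall_2[of Q] by metis
qed

lemma sum_bit: "(\<Sum>i\<in>UNIV. f i) = f 0 + f (1::2)"
  for f :: "2 \<Rightarrow> 'b::comm_monoid_add"
proof -
  have "(2::2) = 0" by simp
  thus ?thesis using sum_2[of f] by (metis add.commute)
qed

lemma adj_nth [simp]: "adj A $ i $ j = cnj (A $ j $ i)"
  by (simp add: adj_def transpose_def map_matrix_def)

lemma adj_adj [simp]: "adj (adj A) = A"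
  by (simp add: vec_eq_iff)

lemma adj_matrix_mult: "adj (A ** B) = adj B ** adj A"
  by (simp add: vec_eq_iff matrix_matrix_mult_def mult.commute)

lemma adj_add: "adj (A + B) = adj A + adj B"
  by (simp add: vec_eq_iff)

lemma adj_scaleR: "adj (r *\<^sub>R A) = r *\<^sub>R adj A"
  by (simp add: vec_eq_iff)

lemma adj_sum: "adj (\<Sum>i\<in>I. f i) = (\<Sum>i\<in>I. adj (f i))"
  by (simp add: vec_eq_iff)

lemma adj_mat_1 [simp]: "adj (mat 1) = mat 1"
  by (auto simp: vec_eq_iff mat_def)

lemma adj_cscale: "adj (cscale c A) = cscale (cnj c) (adj A)"
  by (simp add: vec_eq_iff cscale_def map_matrix_def)

lemma cinner_matrix_mult: "cinner u (A *v v) = cinner (adj A *v u) v"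
  unfolding cinner_def matrix_vector_mult_def
  by (simp add: sum_distrib_left sum_distrib_right mult_ac) (rule sum.swap)

lemma matrix_mult_add_rdistrib: "(A + B) ** C = A ** C + B ** C"
  for A B :: "'a::semiring_1^'n^'m"
  by (simp add: vec_eq_iff matrix_matrix_mult_def distrib_right sum.distrib)

lemma matrix_mult_sum_left: "(\<Sum>i\<in>I. f i) ** B = (\<Sum>i\<in>I. f i ** B)"
  for B :: "complex^'n^'m"
  by (induction I rule: infinite_finite_induct) (auto simp: matrix_mult_add_rdistrib)

lemma matrix_mult_sum_right: "B ** (\<Sum>i\<in>I. f i) = (\<Sum>i\<in>I. B ** f i)"
  for B :: "complex^'n^'m"
  by (induction I rule: infinite_finite_induct) (auto simp: matrix_add_ldistrib)

text \<open>
  Positivity without normalisation: the states before division by the outcome probability have it, and it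
  is closed under sums and conjugation.
\<close>
definition psd :: "complex^'n^'n \<Rightarrow> bool" where
  "psd \<rho> \<longleftrightarrow> hermitian \<rho> \<and> (\<forall>v. 0 \<le> Re (cinner v (\<rho> *v v)))"

lemma density_matrix_iff_psd: "density_matrix \<rho> \<longleftrightarrow> psd \<rho> \<and> trace \<rho> = 1"
  by (auto simp: density_matrix_def psd_def)

lemma psd_conjugation:
  assumes "psd \<rho>"
  shows "psd (V ** \<rho> ** adj V)"
proof -
  have "cinner v (V ** \<rho> ** adj V *v v) = cinner (adj V *v v) (\<rho> *v (adj V *v v))" for v
    using cinner_matrix_mult[of v V "\<rho> *v (adj V *v v)"]
    by (simp add: matrix_vector_mul_assoc matrix_mul_assoc)
  thus ?thesis using assms by (simp add: psd_def hermitian_def adj_matrix_mult matrix_mul_assoc)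
qed

lemma psd_sum:
  assumes "\<And>i. i \<in> I \<Longrightarrow> psd (f i)"
  shows "psd (\<Sum>i\<in>I. f i)"
proof -
  have 0: "psd (0::complex^'n^'n)"
    by (simp add: psd_def hermitian_def cinner_def vec_eq_iff)
  have add: "psd (A + B)" if "psd A" "psd B" for A B :: "complex^'n^'n"
    using that by (simp add: psd_def hermitian_def adj_add matrix_vector_mult_add_rdistrib
        cinner_def distrib_left sum.distrib)
  show ?thesis
    using assms by (induction I rule: infinite_finite_induct) (auto intro: 0 add)
qed

lemma psd_scaleR:
  assumes "psd A" "r \<ge> 0"
  shows "psd (r *\<^sub>R A)"
proof -
  have "cinner v ((r *\<^sub>R A) *v v) = r *\<^sub>R cinner v (A *v v)" for v
    by (simp add: cinner_def matrix_vector_mult_def scaleR_sum_right sum_distrib_left)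
  thus ?thesis using assms by (simp add: psd_def hermitian_def adj_scaleR)
qed

text \<open>
  The trace bounds each of the four entries: the diagonal ones are nonnegative, and the test vectors
  \<open>(1, \<plusminus>1)\<close> and \<open>(1, \<plusminus>\<i>)\<close> bound the real and imaginary part of the off-diagonal ones by half the trace.
\<close>
lemma psd_norm_le_trace:
  fixes \<rho> :: op2
  assumes "psd \<rho>"
  shows "norm \<rho> \<le> 4 * Re (trace \<rho>)"
proof -
  define a b c d where "a = \<rho> $ 0 $ 0" and "b = \<rho> $ 0 $ 1" and "c = \<rho> $ 1 $ 0" and "d = \<rho> $ 1 $ 1"
  have herm: "cnj (\<rho> $ j $ i) = \<rho> $ i $ j" for i j
    using assms adj_nth[of \<rho> i j] by (simp add: psd_def hermitian_def)
  have q: "0 \<le> Re (cnj x * (a * x + b * y) + cnj y * (c * x + d * y))" for x y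
  proof -
    have "0 \<le> Re (cinner (\<chi> i. if i = 0 then x else y) (\<rho> *v (\<chi> i. if i = 0 then x else y)))"
      using assms by (auto simp: psd_def)
    thus ?thesis by (simp add: cinner_def matrix_vector_mult_def sum_bit a_def b_def c_def d_def)
  qed
  have im: "Im a = 0" "Im d = 0" "c = cnj b"
    using herm[of 0 0] herm[of 1 1] herm[of 1 0] by (auto simp: a_def b_def c_def d_def complex_eq_iff)
  have diag: "Re a \<ge> 0" "Re d \<ge> 0" using q[of 1 0] q[of 0 1] by auto
  have off: "\<bar>Re b\<bar> \<le> (Re a + Re d) / 2" "\<bar>Im b\<bar> \<le> (Re a + Re d) / 2"
    using q[of 1 1] q[of 1 "-1"] q[of 1 \<i>] q[of 1 "-\<i>"] by (auto simp: im)
  have ad: "norm a \<le> Re a + Re d" "norm d \<le> Re a + Re d"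
    using cmod_le[of a] cmod_le[of d] diag im by auto
  have bc: "norm b \<le> Re a + Re d" "norm c \<le> Re a + Re d"
    using cmod_le[of b] off by (auto simp: im)
  have "norm \<rho> \<le> (\<Sum>i\<in>UNIV. norm (\<rho> $ i))" unfolding norm_vec_def by (rule L2_set_le_sum) simp
  also have "\<dots> \<le> (\<Sum>i\<in>UNIV. \<Sum>j\<in>UNIV. norm (\<rho> $ i $ j))"
    unfolding norm_vec_def[of "\<rho> $ _"] by (intro sum_mono L2_set_le_sum) simp
  also have "\<dots> = norm a + norm b + norm c + norm d"
    by (simp add: sum_bit a_def b_def c_def d_def)
  also have "\<dots> \<le> 4 * (Re a + Re d)" using ad bc by simp
  also have "Re a + Re d = Re (trace \<rho>)" by (simp add: trace_def sum_bit a_def d_def)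
  finally show ?thesis .
qed

lemma density_matrix_norm_le: "density_matrix \<rho> \<Longrightarrow> norm \<rho> \<le> 4" for \<rho> :: op2
  using psd_norm_le_trace[of \<rho>] by (simp add: density_matrix_iff_psd)

lemma closed_density_matrices: "closed {\<rho> :: op2. density_matrix \<rho>}"
proof -
  have adj: "continuous_on UNIV (adj :: op2 \<Rightarrow> op2)"
    by (intro linear_continuous_on) (simp add: linear_conv_bounded_linear[symmetric] linear_iff adj_add adj_scaleR)
  have form: "continuous_on UNIV (\<lambda>\<rho> :: op2. Re (cinner v (\<rho> *v v)))" for v
    unfolding cinner_def matrix_vector_mult_def by (simp, intro continuous_intros)
  have tr: "continuous_on UNIV (\<lambda>\<rho> :: op2. trace \<rho>)"
    unfolding trace_def by (intro continuous_intros)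
  show ?thesis unfolding density_matrix_def hermitian_def
    by (intro closed_Collect_conj closed_Collect_all closed_Collect_eq closed_Collect_le
        adj form tr continuous_on_const continuous_on_id)
qed

section \<open>Indirect measurements in Kraus form\<close>

text \<open>
  The isometry \<open>v \<mapsto> v \<otimes> a\<close> for a unit vector \<open>a\<close>. With it, the state \<open>\<rho> \<otimes> a a\<^sup>\<dagger>\<close> factors as a conjugation of
  \<open>\<rho>\<close>, so that measurements become products of matrices.
\<close>
definition ket :: "complex^2 \<Rightarrow> complex^2^(2 \<times> 2)" where
  "ket a = (\<chi> p i. if fst p = i then a $ snd p else 0)"

lemma sum_UNIV_prod: "(\<Sum>p\<in>UNIV. f p) = (\<Sum>i\<in>UNIV. \<Sum>k\<in>UNIV. f (i, k))"
  by (simp add: sum.cartesian_product flip: UNIV_Times_UNIV)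

lemma tensor_outer: "\<rho> \<otimes>\<^sub>o outer a b = ket a ** \<rho> ** adj (ket b)"
  by (auto simp: vec_eq_iff tensor_def outer_def ket_def matrix_matrix_mult_def sum_bit all_bit mult_ac)

lemma tensor_mult_ket: "(A \<otimes>\<^sub>o B) ** ket a = ket (B *v a) ** A"
  by (auto simp: vec_eq_iff tensor_def ket_def matrix_matrix_mult_def matrix_vector_mult_def
      sum_UNIV_prod sum_bit all_bit algebra_simps)

lemma adj_ket_mult_ket: "adj (ket a) ** ket b = mat (cinner a b)"
  by (auto simp: vec_eq_iff ket_def matrix_matrix_mult_def mat_def cinner_def sum_UNIV_prod sum_bit all_bit)

lemma adj_tensor: "adj (A \<otimes>\<^sub>o B) = adj A \<otimes>\<^sub>o adj B"
  by (simp add: vec_eq_iff tensor_def)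

text \<open>
  This evaluates one step for \<open>j = 0\<close>: the probe starts in \<open>e 0\<close>, which selects the first block column.
\<close>
lemma from_blocks_mult_ket:
  assumes "orthonormal_basis e"
  shows "from_blocks e B ** ket (e j) = (\<Sum>i\<in>UNIV. ket (e i) ** B i j)"
proof -
  have "(X \<otimes>\<^sub>o outer (e i) (e k)) ** ket (e j) = (if k = j then ket (e i) ** X else 0)" for X i k
    using assms by (auto simp: tensor_outer matrix_mul_assoc[symmetric] adj_ket_mult_ket orthonormal_basis_def)
  thus ?thesis by (simp add: from_blocks_def matrix_mult_sum_left)
qed

text \<open>
  The operator of the outcome \<open>j\<close> followed by reading off coordinate \<open>k\<close> of the probe; the sum over \<open>k\<close> is
  the partial trace.
\<close>
definition kraus :: "(2 \<Rightarrow> complex^2) \<Rightarrow> (2 \<Rightarrow> 2 \<Rightarrow> op2) \<Rightarrow> (2 \<Rightarrow> op2) \<Rightarrow> 2 \<Rightarrow> 2 \<Rightarrow> op2" where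
  "kraus e B P j k = (\<Sum>i\<in>UNIV. cscale ((P j *v e i) $ k) (B i 0))"

text \<open>
  \<open>W = (1 \<otimes> P\<^sub>j) U (\<cdot> \<otimes> e\<^sub>0)\<close> maps the system into the composite system, and the unnormalised state is the partial
  trace of \<open>W \<rho> W\<^sup>\<dagger>\<close>. Cutting \<open>W\<close> along the probe coordinate gives the Kraus operators.
\<close>
lemma measured_eq_kraus:
  assumes "orthonormal_basis e" "hermitian (P j)"
  shows "measured (from_blocks e B) (outer (e 0) (e 0)) P \<rho> j =
         (\<Sum>k\<in>UNIV. kraus e B P j k ** \<rho> ** adj (kraus e B P j k))"
proof -
  define W where "W = (\<Sum>i\<in>UNIV. ket (P j *v e i) ** B i 0)"
  have W: "(mat 1 \<otimes>\<^sub>o P j) ** from_blocks e B ** ket (e 0) = W"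
    by (simp add: W_def from_blocks_mult_ket[OF assms(1)] matrix_mult_sum_right matrix_mul_assoc
        tensor_mult_ket flip: matrix_mul_assoc[of "mat 1 \<otimes>\<^sub>o P j" "from_blocks e B"])
  have adjP: "adj (mat 1 \<otimes>\<^sub>o P j) = mat 1 \<otimes>\<^sub>o P j"
    using assms(2) by (simp add: adj_tensor hermitian_def)
  have "(mat 1 \<otimes>\<^sub>o P j) ** from_blocks e B ** (\<rho> \<otimes>\<^sub>o outer (e 0) (e 0)) ** adj (from_blocks e B) ** (mat 1 \<otimes>\<^sub>o P j)
        = W ** \<rho> ** adj W"
    by (simp add: adj_matrix_mult adjP tensor_outer matrix_mul_assoc flip: W)
  moreover have "\<forall>a. W $ (a, k) $ b = kraus e B P j k $ a $ b" for b k
    by (auto simp: all_bit W_def kraus_def ket_def cscale_def map_matrix_def matrix_matrix_mult_def sum_bit)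
  ultimately show ?thesis
    by (simp add: measured_def partial_trace_def vec_eq_iff matrix_matrix_mult_def)
qed

text \<open>
  Forgetting the outcome leaves the partial trace of the state before the measurement: the coefficients of \<open>B\<^sub>i\<^sub>0 \<rho> B\<^sub>k\<^sub>0\<^sup>\<dagger>\<close> add up to
  \<open>\<Sum>\<^sub>j \<langle>P\<^sub>j e\<^sub>k, P\<^sub>j e\<^sub>i\<rangle> = \<langle>e\<^sub>k, (P\<^sub>0 + P\<^sub>1) e\<^sub>i\<rangle>\<close>.
\<close>
lemma sum_kraus:
  assumes e: "orthonormal_basis e" and P: "\<And>j. hermitian (P j)" "\<And>j. P j ** P j = P j" "P 0 + P 1 = mat 1"
  shows "(\<Sum>j\<in>UNIV. \<Sum>k\<in>UNIV. kraus e B P j k ** \<rho> ** adj (kraus e B P j k)) =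
         (\<Sum>i\<in>UNIV. B i 0 ** \<rho> ** adj (B i 0))"
proof -
  have cscale_mult: "cscale x A ** \<rho> ** adj (cscale y C) = cscale (x * cnj y) (A ** \<rho> ** adj C)" for x y and A C :: op2
    by (simp add: vec_eq_iff cscale_def map_matrix_def matrix_matrix_mult_def sum_distrib_left sum_distrib_right mult_ac)
  have cscale_add: "cscale (x + y) A = cscale x A + cscale y A" for x y and A :: op2
    by (simp add: vec_eq_iff cscale_def map_matrix_def distrib_right)
  have ortho: "(\<Sum>j\<in>UNIV. \<Sum>k\<in>UNIV. (P j *v e i) $ k * cnj ((P j *v e i') $ k)) = (if i' = i then 1 else 0)" for i i'
  proof -
    have "(\<Sum>k\<in>UNIV. (P j *v e i) $ k * cnj ((P j *v e i') $ k)) = cinner (e i') (P j *v e i)" for j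
    proof -
      have "cinner (P j *v e i') (P j *v e i) = cinner (e i') (P j *v e i)"
        using cinner_matrix_mult[of "e i'" "P j" "P j *v e i"] P(1,2)[of j]
        by (simp add: matrix_vector_mul_assoc hermitian_def)
      thus ?thesis by (simp add: cinner_def mult.commute)
    qed
    hence "(\<Sum>j\<in>UNIV. \<Sum>k\<in>UNIV. (P j *v e i) $ k * cnj ((P j *v e i') $ k)) = cinner (e i') ((P 0 + P 1) *v e i)"
      by (simp add: sum_bit matrix_vector_mult_add_rdistrib cinner_def algebra_simps)
    also have "\<dots> = (if i' = i then 1 else 0)" using e by (simp add: P(3) orthonormal_basis_def)
    finally show ?thesis .
  qed
  have "(\<Sum>j\<in>UNIV. \<Sum>k\<in>UNIV. kraus e B P j k ** \<rho> ** adj (kraus e B P j k))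
      = (\<Sum>j\<in>UNIV. \<Sum>k\<in>UNIV. \<Sum>i\<in>UNIV. \<Sum>i'\<in>UNIV.
          cscale ((P j *v e i) $ k * cnj ((P j *v e i') $ k)) (B i 0 ** \<rho> ** adj (B i' 0)))"
    unfolding kraus_def adj_sum matrix_mult_sum_left matrix_mult_sum_right cscale_mult
    by (intro sum.cong refl sum.swap)
  also have "\<dots> = (\<Sum>i\<in>UNIV. \<Sum>i'\<in>UNIV. cscale (\<Sum>j\<in>UNIV. \<Sum>k\<in>UNIV.
          (P j *v e i) $ k * cnj ((P j *v e i') $ k)) (B i 0 ** \<rho> ** adj (B i' 0)))"
    unfolding sum_bit by (simp add: cscale_add add_ac)
  also have "\<dots> = (\<Sum>i\<in>UNIV. B i 0 ** \<rho> ** adj (B i 0))"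
    unfolding ortho by (simp add: sum_bit cscale_def map_matrix_def vec_eq_iff)
  finally show ?thesis .
qed

lemma sum_measured:
  assumes "orthonormal_basis e" "\<And>j. hermitian (P j)" "\<And>j. P j ** P j = P j" "P 0 + P 1 = mat 1"
  shows "(\<Sum>j\<in>UNIV. measured (from_blocks e B) (outer (e 0) (e 0)) P \<rho> j) =
         (\<Sum>i\<in>UNIV. B i 0 ** \<rho> ** adj (B i 0))"
  using sum_kraus[of e P B \<rho>] assms by (simp add: measured_eq_kraus)

text \<open>
  The block column is the composition of \<open>\<cdot> \<otimes> e\<^sub>j\<close> with a unitary, hence an isometry.
\<close>
lemma unitary_blocks_normalised:
  assumes "orthonormal_basis e" "unitary (from_blocks e B)"
  shows "(\<Sum>i\<in>UNIV. adj (B i j) ** B i j) = mat 1"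
proof -
  define W where "W = from_blocks e B ** ket (e j)"
  have "adj W ** W = adj (ket (e j)) ** (adj (from_blocks e B) ** from_blocks e B) ** ket (e j)"
    by (simp add: W_def adj_matrix_mult matrix_mul_assoc)
  also have "\<dots> = mat 1"
    using assms by (simp add: unitary_def adj_ket_mult_ket orthonormal_basis_def)
  finally have "adj W ** W = mat 1" .
  moreover have "(adj (B i j) ** adj (ket (e i))) ** (ket (e k) ** B k j) =
      (if i = k then adj (B i j) ** B i j else 0)" for i k
  proof -
    have "(adj (B i j) ** adj (ket (e i))) ** (ket (e k) ** B k j) =
        adj (B i j) ** (adj (ket (e i)) ** ket (e k)) ** B k j" by (simp add: matrix_mul_assoc)
    thus ?thesis using assms(1) by (auto simp: adj_ket_mult_ket orthonormal_basis_def)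
  qed
  ultimately show ?thesis
    by (simp add: W_def from_blocks_mult_ket[OF assms(1)] adj_sum adj_matrix_mult
        matrix_mult_sum_left matrix_mult_sum_right)
qed


lemma trace_mult_commute: "trace (A ** B) = trace (B ** A)"
  for A :: "complex^'n^'m"
  unfolding trace_def matrix_matrix_mult_def
  by (simp add: mult.commute) (rule sum.swap)

lemma trace_sum: "trace (\<Sum>i\<in>I. f i) = (\<Sum>i\<in>I. trace (f i :: complex^'n^'n))"
  unfolding trace_def sum_component by (rule sum.swap)

lemma trace_channel:
  assumes "orthonormal_basis e" "unitary (from_blocks e B)"
  shows "trace (\<Sum>i\<in>UNIV. B i j ** \<rho> ** adj (B i j)) = trace \<rho>"
proof -
  have "trace (B i j ** \<rho> ** adj (B i j)) = trace (adj (B i j) ** B i j ** \<rho>)" for i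
    using trace_mult_commute[of "B i j ** \<rho>" "adj (B i j)"] by (simp add: matrix_mul_assoc)
  hence "trace (\<Sum>i\<in>UNIV. B i j ** \<rho> ** adj (B i j)) =
      trace ((\<Sum>i\<in>UNIV. adj (B i j) ** B i j) ** \<rho>)"
    by (simp add: trace_sum matrix_mult_sum_left)
  thus ?thesis by (simp add: unitary_blocks_normalised[OF assms])
qed

lemma psd_trace_real: "psd \<rho> \<Longrightarrow> trace \<rho> = complex_of_real (Re (trace \<rho>))"
proof -
  assume "psd \<rho>"
  hence "cnj (\<rho> $ i $ i) = \<rho> $ i $ i" for i
    using adj_nth[of \<rho> i i] by (simp add: psd_def hermitian_def)
  hence "cnj (trace \<rho>) = trace \<rho>" by (simp add: trace_def)
  thus ?thesis by (simp add: complex_eq_iff)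
qed

text \<open>
  One step: a probe in the state \<open>e 0\<close> interacts with the system through the unitary with blocks \<open>B\<close> and is
  then measured.
\<close>
locale indirect_measurement =
  fixes e :: "2 \<Rightarrow> complex^2" and P :: "2 \<Rightarrow> op2" and B :: "2 \<Rightarrow> 2 \<Rightarrow> op2"
  assumes basis: "orthonormal_basis e"
    and hermitian_P: "\<And>j. hermitian (P j)" and idem_P: "\<And>j. P j ** P j = P j"
    and complete_P: "P 0 + P 1 = mat 1"
    and unitary: "unitary (from_blocks e B)"
begin

abbreviation "meas \<equiv> measured (from_blocks e B) (outer (e 0) (e 0)) P"
abbreviation "prb \<equiv> outcome_prob (from_blocks e B) (outer (e 0) (e 0)) P"
abbreviation "state \<equiv> outcome_state (from_blocks e B) (outer (e 0) (e 0)) P"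

lemma psd_measured: "psd \<rho> \<Longrightarrow> psd (meas \<rho> j)"
  by (simp add: measured_eq_kraus[OF basis hermitian_P] psd_sum psd_conjugation)

lemma outcome_prob_nonneg: "psd \<rho> \<Longrightarrow> 0 \<le> prb \<rho> j"
  using order.trans[OF norm_ge_zero psd_norm_le_trace[OF psd_measured]]
  by (simp add: outcome_prob_def)

lemma sum_outcome_prob: "density_matrix \<rho> \<Longrightarrow> (\<Sum>j\<in>UNIV. prb \<rho> j) = 1"
proof -
  assume "density_matrix \<rho>"
  moreover have "(\<Sum>j\<in>UNIV. prb \<rho> j) = Re (trace (\<Sum>j\<in>UNIV. meas \<rho> j))"
    by (simp add: outcome_prob_def trace_sum)
  ultimately show ?thesis
    by (simp add: sum_measured[OF basis hermitian_P idem_P complete_P]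
        trace_channel[OF basis unitary] density_matrix_def)
qed

lemma density_outcome_state:
  assumes "psd \<rho>" "prb \<rho> j \<noteq> 0"
  shows "density_matrix (state \<rho> j)"
proof -
  have "trace (state \<rho> j) = trace (meas \<rho> j) /\<^sub>R prb \<rho> j"
    by (simp add: outcome_state_def trace_def scaleR_sum_right)
  also have "\<dots> = 1"
    using psd_trace_real[OF psd_measured[OF assms(1), of j]] assms(2)
    by (metis (no_types) outcome_prob_def of_real_1 of_real_mult left_inverse scaleR_conv_of_real)
  finally show ?thesis
    using psd_measured[OF assms(1), of j] outcome_prob_nonneg[OF assms(1), of j]
    by (simp add: density_matrix_iff_psd outcome_state_def psd_scaleR)
qed

text \<open>
  For an outcome of probability zero both sides vanish: the unnormalised state is positive semidefinite with
  trace zero.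
\<close>
lemma prob_times_state:
  assumes "psd \<rho>"
  shows "prb \<rho> j *\<^sub>R state \<rho> j = meas \<rho> j"
proof (cases "prb \<rho> j = 0")
  case True
  hence "meas \<rho> j = 0"
    using psd_norm_le_trace[OF psd_measured[OF assms, of j]] by (simp add: outcome_prob_def)
  with True show ?thesis by simp
qed (simp add: outcome_state_def)

end

section \<open>The mean of a quantum trajectory\<close>

text \<open>
  The hypothesis \<open>law\<close> says that given \<open>X\<close>, the variable \<open>Y\<close> takes the value \<open>s j X\<close> with probability \<open>p j X\<close>, but
  \<open>Y\<close> need not be a function of \<open>X\<close> and an outcome on the given space. Drawing the outcome on the product with
  a counting measure, weighted by \<open>p\<close>, realises the law of \<open>Y\<close>, and Fubini's theorem evaluates the integral there.
\<close>
lemma (in prob_space) expectation_of_finite_kernel_step: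
  fixes X Y :: "'a \<Rightarrow> 'b::euclidean_space" and p :: "'j::finite \<Rightarrow> 'b \<Rightarrow> real"
  assumes [measurable]: "X \<in> borel_measurable M" "Y \<in> borel_measurable M"
    "\<And>j. p j \<in> borel_measurable borel" "\<And>j. s j \<in> borel_measurable borel"
    and p: "AE w in M. (\<forall>j. 0 \<le> p j (X w)) \<and> (\<Sum>j\<in>UNIV. p j (X w)) = 1"
    and law: "\<And>S. S \<in> sets borel \<Longrightarrow> prob {w \<in> space M. Y w \<in> S} =
                expectation (\<lambda>w. \<Sum>j\<in>UNIV. p j (X w) * indicat_real S (s j (X w)))"
    and bound: "AE w in M. \<forall>j. norm (p j (X w) *\<^sub>R s j (X w)) \<le> B"
  shows "expectation Y = expectation (\<lambda>w. \<Sum>j\<in>UNIV. p j (X w) *\<^sub>R s j (X w))"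
proof -
  let ?C = "count_space (UNIV :: 'j set)"
  let ?N = "M \<Otimes>\<^sub>M ?C"
  interpret C: finite_measure ?C by (rule finite_measure_count_space) simp
  interpret N: pair_sigma_finite M ?C ..
  interpret NF: finite_measure ?N by (rule finite_measure_pair_measure) unfold_locales
  have [measurable]: "(\<lambda>z. p (snd z) (X (fst z))) \<in> borel_measurable ?N"
    by (rule measurable_compose_countable'[where f = "\<lambda>j z. p j (X (fst z))" and I = UNIV])
       (auto intro: countable_finite)
  have [measurable]: "(\<lambda>z. s (snd z) (X (fst z))) \<in> borel_measurable ?N"
    by (rule measurable_compose_countable'[where f = "\<lambda>j z. s j (X (fst z))" and I = UNIV])
       (auto intro: countable_finite)
  have p_le: "AE w in M. \<forall>j. 0 \<le> p j (X w) \<and> p j (X w) \<le> 1"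
    using p
  proof eventually_elim
    case (elim w)
    thus ?case using member_le_sum[of _ UNIV "\<lambda>j. p j (X w)"] by auto
  qed
  have p_nonneg: "AE z in ?N. 0 \<le> p (snd z) (X (fst z))"
    by (rule N.AE_pair_measure) (use p in \<open>auto simp: AE_count_space\<close>)
  have p_bound: "AE z in ?N. norm (p (snd z) (X (fst z)) *\<^sub>R s (snd z) (X (fst z))) \<le> B"
    by (rule N.AE_pair_measure) (use bound in \<open>auto simp: AE_count_space\<close>)
  have eq: "distr M borel Y = distr (density ?N (\<lambda>z. ennreal (p (snd z) (X (fst z))))) borel (\<lambda>z. s (snd z) (X (fst z)))"
  proof (rule measure_eqI)
    fix S assume "S \<in> sets (distr M borel Y)"
    hence S [measurable]: "S \<in> sets borel" by simp
    let ?f = "\<lambda>w. \<Sum>j\<in>UNIV. p j (X w) * indicat_real S (s j (X w))"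
    have int: "integrable M ?f"
    proof (rule integrable_const_bound)
      show "AE w in M. norm (?f w) \<le> real CARD('j)"
        using p_le
      proof eventually_elim
        case (elim w)
        have "norm (?f w) \<le> (\<Sum>j\<in>(UNIV::'j set). norm (p j (X w) * indicat_real S (s j (X w))))" by (rule norm_sum)
        also have "\<dots> \<le> (\<Sum>j\<in>(UNIV::'j set). 1)"
          using elim by (intro sum_mono) (auto simp: indicator_def)
        finally show ?case by simp
      qed
    qed measurable
    have "emeasure (distr (density ?N (\<lambda>z. ennreal (p (snd z) (X (fst z))))) borel (\<lambda>z. s (snd z) (X (fst z)))) S
        = (\<integral>\<^sup>+z. ennreal (p (snd z) (X (fst z))) * indicator ((\<lambda>z. s (snd z) (X (fst z))) -` S \<inter> space ?N) z \<partial>?N)"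
      by (simp add: emeasure_distr emeasure_density)
    also have "\<dots> = (\<integral>\<^sup>+z. ennreal (p (snd z) (X (fst z)) * indicat_real S (s (snd z) (X (fst z)))) \<partial>?N)"
      by (intro nn_integral_cong) (auto simp: indicator_def)
    also have "\<dots> = (\<integral>\<^sup>+w. \<integral>\<^sup>+j. ennreal (p j (X w) * indicat_real S (s j (X w))) \<partial>?C \<partial>M)"
      using C.nn_integral_fst[of "\<lambda>z. ennreal (p (snd z) (X (fst z)) * indicat_real S (s (snd z) (X (fst z))))" M]
      by simp
    also have "\<dots> = (\<integral>\<^sup>+w. ennreal (?f w) \<partial>M)"
    proof (rule nn_integral_cong_AE)
      show "AE w in M. (\<integral>\<^sup>+j. ennreal (p j (X w) * indicat_real S (s j (X w))) \<partial>?C) = ennreal (?f w)"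
        using p_le
      proof eventually_elim
        case (elim w)
        hence "(\<Sum>j\<in>UNIV. ennreal (p j (X w) * indicat_real S (s j (X w)))) = ennreal (?f w)"
          by (intro sum_ennreal) simp
        thus ?case by (subst nn_integral_count_space_finite) simp_all
      qed
    qed
    also have "\<dots> = ennreal (expectation ?f)"
    proof (intro nn_integral_eq_integral int)
      show "AE w in M. 0 \<le> ?f w"
        using p_le by eventually_elim (auto intro!: sum_nonneg)
    qed
    also have "\<dots> = ennreal (prob {w \<in> space M. Y w \<in> S})" by (simp only: law[OF S])
    also have "\<dots> = emeasure (distr M borel Y) S"
      by (simp add: emeasure_distr emeasure_eq_measure vimage_def Int_def conj_commute)
    finally show "emeasure (distr M borel Y) S = emeasure (distr (density ?N (\<lambda>z. ennreal (p (snd z) (X (fst z))))) borel (\<lambda>z. s (snd z) (X (fst z)))) S" ..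
  qed simp
  have "expectation Y = (\<integral>y. y \<partial>distr M borel Y)" by (subst integral_distr) auto
  also have "\<dots> = (\<integral>z. p (snd z) (X (fst z)) *\<^sub>R s (snd z) (X (fst z)) \<partial>?N)"
    unfolding eq using p_nonneg by (subst integral_distr; simp) (subst integral_density; simp)
  also have "\<dots> = (\<integral>w. \<integral>j. p j (X w) *\<^sub>R s j (X w) \<partial>?C \<partial>M)"
  proof (subst N.integral_fst'[symmetric])
    show "integrable ?N (\<lambda>z. p (snd z) (X (fst z)) *\<^sub>R s (snd z) (X (fst z)))"
      by (rule NF.integrable_const_bound[OF p_bound]) measurable
  qed simp
  also have "\<dots> = expectation (\<lambda>w. \<Sum>j\<in>UNIV. p j (X w) *\<^sub>R s j (X w))"
    by (simp add: lebesgue_integral_count_space_finite)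
  finally show ?thesis .
qed

lemma linear_sandwich: "linear (\<lambda>\<rho>. A ** \<rho> ** C)"
  for A :: "complex^'n^'m" and C :: "complex^'k^'l"
  by (auto simp: linear_iff vec_eq_iff matrix_matrix_mult_def scaleR_sum_right sum.distrib
      distrib_left distrib_right sum_distrib_left sum_distrib_right)

lemma subalgebra_past:
  assumes "\<And>i. X i \<in> borel_measurable M"
  shows "subalgebra M (past M X k)"
proof -
  have "{X i -` S \<inter> space M | i S. i \<le> k \<and> S \<in> sets borel} \<subseteq> sets M"
    using assms by (auto intro: measurable_sets)
  hence "sigma_sets (space M) {X i -` S \<inter> space M | i S. i \<le> k \<and> S \<in> sets borel} \<subseteq> sets M"
    by (rule sets.sigma_sets_subset)
  thus ?thesis unfolding past_def subalgebra_def
    by (subst sets_measure_of) (use sets.sets_into_space assms in \<open>auto simp: space_measure_of_conv\<close>)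
qed

lemma continuous_on_measured: "continuous_on UNIV (\<lambda>\<rho>. measured U \<beta> P \<rho> j)"
  unfolding measured_def partial_trace_def tensor_def matrix_matrix_mult_def
  by (simp, intro continuous_intros)

lemma measurable_outcomes [measurable]:
  "(\<lambda>\<rho>. measured U \<beta> P \<rho> j) \<in> borel_measurable borel"
  "(\<lambda>\<rho>. outcome_prob U \<beta> P \<rho> j) \<in> borel_measurable borel"
  "(\<lambda>\<rho>. outcome_state U \<beta> P \<rho> j) \<in> borel_measurable borel"
proof -
  show [measurable]: "(\<lambda>\<rho>. measured U \<beta> P \<rho> j) \<in> borel_measurable borel"
    by (rule borel_measurable_continuous_onI[OF continuous_on_measured])
  show [measurable]: "(\<lambda>\<rho>. outcome_prob U \<beta> P \<rho> j) \<in> borel_measurable borel"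
    unfolding outcome_prob_def trace_def
    by (intro borel_measurable_continuous_onI continuous_intros continuous_on_measured)
  show "(\<lambda>\<rho>. outcome_state U \<beta> P \<rho> j) \<in> borel_measurable borel"
    unfolding outcome_state_def by measurable
qed

text \<open>
  The expectation of the conditional law given the past is the law of the next state.
\<close>
lemma quantum_trajectory_step_law:
  assumes traj: "quantum_trajectory M U \<beta> P \<rho>0 X" and S: "S \<in> sets borel"
  shows "measure M {w \<in> space M. X (Suc k) w \<in> S} =
         (\<integral>w. (\<Sum>j\<in>UNIV. outcome_prob (U (Suc k)) \<beta> P (X k w) j *
                 indicat_real S (outcome_state (U (Suc k)) \<beta> P (X k w) j)) \<partial>M)"
proof -
  interpret prob_space M using traj by (simp add: quantum_trajectory_def)
  have X [measurable]: "X i \<in> borel_measurable M" for i using traj by (simp add: quantum_trajectory_def)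
  note S [measurable]
  interpret finite_measure_subalgebra M "past M X k"
    by unfold_locales (rule subalgebra_past[OF X])
  let ?A = "{w \<in> space M. X (Suc k) w \<in> S}"
  have int: "integrable M (indicat_real ?A)" by (simp add: emeasure_eq_measure)
  have "measure M ?A = (\<integral>w. indicat_real ?A w \<partial>M)" by simp
  also have "\<dots> = (\<integral>w. real_cond_exp M (past M X k) (indicat_real ?A) w \<partial>M)"
    by (rule real_cond_exp_int(2)[OF int, symmetric])
  also have "\<dots> = (\<integral>w. (\<Sum>j\<in>UNIV. outcome_prob (U (Suc k)) \<beta> P (X k w) j *
                 indicat_real S (outcome_state (U (Suc k)) \<beta> P (X k w) j)) \<partial>M)"
  proof (rule integral_cong_AE)
    show "AE w in M. real_cond_exp M (past M X k) (indicat_real ?A) w =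
        (\<Sum>j\<in>UNIV. outcome_prob (U (Suc k)) \<beta> P (X k w) j *
                 indicat_real S (outcome_state (U (Suc k)) \<beta> P (X k w) j))"
      using traj S unfolding quantum_trajectory_def by blast
  qed measurable
  finally show ?thesis .
qed

text \<open>
  The blocks of the unitary may vary from step to step; in the application they alternate between two families.
\<close>
locale indirect_measurement_chain =
  fixes e :: "2 \<Rightarrow> complex^2" and P :: "2 \<Rightarrow> op2" and B :: "nat \<Rightarrow> 2 \<Rightarrow> 2 \<Rightarrow> op2"
    and M :: "'w measure" and X :: "nat \<Rightarrow> 'w \<Rightarrow> op2" and \<rho>0 :: op2
  assumes measurement: "\<And>k. indirect_measurement e P (B k)"
    and traj: "quantum_trajectory M (\<lambda>k. from_blocks e (B k)) (outer (e 0) (e 0)) P \<rho>0 X"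
    and init: "density_matrix \<rho>0"
begin

sublocale prob_space M using traj by (simp add: quantum_trajectory_def)

sublocale step: indirect_measurement e P "B k" for k by (rule measurement)

lemma measurable_X [measurable]: "X k \<in> borel_measurable M"
  using traj by (simp add: quantum_trajectory_def)

text \<open>
  The law of the next state charges only outcomes of positive probability, whose states are density matrices.
\<close>
lemma AE_density: "AE w in M. density_matrix (X k w)"
proof (induction k)
  case 0
  have "AE w in M. X 0 w = \<rho>0" using traj by (simp add: quantum_trajectory_def)
  thus ?case by eventually_elim (simp add: init)
next
  case (Suc k)
  have D: "{\<rho> :: op2. density_matrix \<rho>} \<in> sets borel"
    by (rule borel_closed[OF closed_density_matrices])
  have "measure M {w \<in> space M. X (Suc k) w \<in> {\<rho>. density_matrix \<rho>}} =
      expectation (\<lambda>w. \<Sum>j\<in>UNIV. step.prb (Suc k) (X k w) j *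
                 indicat_real {\<rho>. density_matrix \<rho>} (step.state (Suc k) (X k w) j))"
    by (rule quantum_trajectory_step_law[OF traj D])
  also have "\<dots> = expectation (\<lambda>w. 1)"
  proof (rule integral_cong_AE)
    show "AE w in M. (\<Sum>j\<in>UNIV. step.prb (Suc k) (X k w) j *
                 indicat_real {\<rho>. density_matrix \<rho>} (step.state (Suc k) (X k w) j)) = 1"
      using Suc
    proof eventually_elim
      case (elim w)
      hence "psd (X k w)" by (simp add: density_matrix_iff_psd)
      hence "(\<Sum>j\<in>UNIV. step.prb (Suc k) (X k w) j *
                 indicat_real {\<rho>. density_matrix \<rho>} (step.state (Suc k) (X k w) j))
          = (\<Sum>j\<in>UNIV. step.prb (Suc k) (X k w) j)"
        by (intro sum.cong refl) (auto simp: indicator_def dest: step.density_outcome_state)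
      thus ?case by (simp add: step.sum_outcome_prob[OF elim])
    qed
  qed (use D in measurable)
  finally have "prob {w \<in> space M. X (Suc k) w \<in> {\<rho>. density_matrix \<rho>}} = 1"
    by (simp add: prob_space)
  moreover have "{w \<in> space M. X (Suc k) w \<in> {\<rho>. density_matrix \<rho>}} \<in> events"
    using D by measurable
  ultimately show ?case by (simp add: prob_Collect_eq_1)
qed

lemma AE_norm_X_le: "AE w in M. norm (X k w) \<le> 4"
  using AE_density[of k] by eventually_elim (rule density_matrix_norm_le)

lemma integrable_X: "integrable M (X k)"
  by (rule integrable_const_bound[OF AE_norm_X_le measurable_X])

text \<open>
  The weight \<open>p\<^sub>j\<close> in the mean cancels the normalisation \<open>1/p\<^sub>j\<close> of the outcome state, which leaves a linear map of
  the present state; it commutes with the expectation.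
\<close>
lemma expectation_step:
  "expectation (X (Suc k)) =
   (\<Sum>i\<in>UNIV. B (Suc k) i 0 ** expectation (X k) ** adj (B (Suc k) i 0))"
proof -
  have meas_bound: "AE w in M. \<forall>j. norm (step.prb (Suc k) (X k w) j *\<^sub>R step.state (Suc k) (X k w) j) \<le> 4"
    using AE_density[of k]
  proof eventually_elim
    case (elim w)
    hence psd: "psd (X k w)" by (simp add: density_matrix_iff_psd)
    have "step.prb (Suc k) (X k w) j \<le> 1" for j
      using step.sum_outcome_prob[OF elim, of "Suc k"] step.outcome_prob_nonneg[OF psd]
        member_le_sum[of j UNIV "step.prb (Suc k) (X k w)"] by auto
    moreover have "norm (step.meas (Suc k) (X k w) j) \<le> 4 * step.prb (Suc k) (X k w) j" for j
      unfolding outcome_prob_def by (rule psd_norm_le_trace[OF step.psd_measured[OF psd]])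
    ultimately have "norm (step.meas (Suc k) (X k w) j) \<le> 4" for j
      by (meson mult_left_mono order.trans mult_left_le zero_le_numeral)
    thus ?case by (simp only: step.prob_times_state[OF psd]) simp
  qed
  have "expectation (X (Suc k)) =
      expectation (\<lambda>w. \<Sum>j\<in>UNIV. step.prb (Suc k) (X k w) j *\<^sub>R step.state (Suc k) (X k w) j)"
  proof (rule expectation_of_finite_kernel_step[where B = 4
        and p = "\<lambda>j \<rho>. step.prb (Suc k) \<rho> j" and s = "\<lambda>j \<rho>. step.state (Suc k) \<rho> j"])
    show "AE w in M. (\<forall>j. 0 \<le> step.prb (Suc k) (X k w) j) \<and> (\<Sum>j\<in>UNIV. step.prb (Suc k) (X k w) j) = 1"
      using AE_density[of k]
      by eventually_elim (simp add: step.sum_outcome_prob step.outcome_prob_nonneg density_matrix_iff_psd[THEN iffD1])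
  qed (use meas_bound quantum_trajectory_step_law[OF traj] in auto)
  also have "\<dots> = expectation (\<lambda>w. \<Sum>j\<in>UNIV. step.meas (Suc k) (X k w) j)"
  proof (rule integral_cong_AE)
    show "AE w in M. (\<Sum>j\<in>UNIV. step.prb (Suc k) (X k w) j *\<^sub>R step.state (Suc k) (X k w) j) =
        (\<Sum>j\<in>UNIV. step.meas (Suc k) (X k w) j)"
      using AE_density[of k] by eventually_elim (simp add: step.prob_times_state density_matrix_iff_psd)
  qed measurable
  also have "\<dots> = expectation (\<lambda>w. \<Sum>i\<in>UNIV. B (Suc k) i 0 ** X k w ** adj (B (Suc k) i 0))"
    by (simp add: sum_measured[OF step.basis step.hermitian_P step.idem_P step.complete_P])
  also have "\<dots> = (\<Sum>i\<in>UNIV. B (Suc k) i 0 ** expectation (X k) ** adj (B (Suc k) i 0))"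
  proof (rule integral_bounded_linear)
    show "bounded_linear (\<lambda>\<rho>. \<Sum>i\<in>UNIV. B (Suc k) i 0 ** \<rho> ** adj (B (Suc k) i 0))"
      unfolding linear_conv_bounded_linear[symmetric]
      by (intro linear_compose_sum ballI linear_sandwich)
  qed (rule integrable_X)
  finally show ?thesis .
qed

lemma norm_expectation_le: "norm (expectation (X k)) \<le> 4"
proof -
  have "norm (expectation (X k)) \<le> expectation (\<lambda>w. norm (X k w))" by (rule integral_norm_bound)
  also have "\<dots> \<le> 4"
    by (rule integral_le_const[OF integrable_norm[OF integrable_X] AE_norm_X_le])
  finally show ?thesis .
qed

lemma expectation_0: "expectation (X 0) = \<rho>0"
proof -
  have "expectation (X 0) = expectation (\<lambda>w. \<rho>0)"
    by (rule integral_cong_AE) (use traj in \<open>auto simp: quantum_trajectory_def\<close>)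
  thus ?thesis by (simp add: prob_space)
qed

end

section \<open>Small time expansion of one step\<close>

lemma cscale_mult_left: "cscale c A ** B = cscale c (A ** B)"
  by (simp add: vec_eq_iff cscale_def map_matrix_def matrix_matrix_mult_def sum_distrib_left mult.assoc)

lemma cscale_mult_right: "A ** cscale c B = cscale c (A ** B)"
  by (simp add: vec_eq_iff cscale_def map_matrix_def matrix_matrix_mult_def sum_distrib_left mult_ac)

lemma cscale_diff: "cscale c (A - B) = cscale c A - cscale c B"
  by (simp add: vec_eq_iff cscale_def map_matrix_def algebra_simps)

lemma cscale_uminus: "cscale (- c) A = - cscale c A"
  by (simp add: vec_eq_iff cscale_def map_matrix_def)

lemma bounded_bilinear_matrix_mult: "bounded_bilinear ((**) :: complex^'n^'m \<Rightarrow> complex^'k^'n \<Rightarrow> complex^'k^'m)"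
proof -
  have "linear (\<lambda>y :: complex^'k^'n. x ** y)" for x :: "complex^'n^'m"
    by (simp add: linear_iff vec_eq_iff matrix_matrix_mult_def scaleR_sum_right distrib_left sum.distrib)
  moreover have "linear (\<lambda>x :: complex^'n^'m. x ** y)" for y :: "complex^'k^'n"
    by (simp add: linear_iff vec_eq_iff matrix_matrix_mult_def scaleR_sum_right distrib_right sum.distrib)
  ultimately show ?thesis by (simp add: bilinear_conv_bounded_bilinear[symmetric] bilinear_def)
qed

lemma bounded_linear_adj: "bounded_linear (adj :: complex^'n^'m \<Rightarrow> complex^'m^'n)"
  by (simp add: linear_conv_bounded_linear[symmetric] linear_iff adj_add adj_scaleR)

lemma bounded_bilinear_sandwich: "bounded_bilinear (\<lambda>(A :: complex^'n^'n) (B :: complex^'n^'n). A ** x ** adj B)"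
  by (rule bounded_bilinear.comp[OF bounded_bilinear_matrix_mult
        bounded_bilinear.bounded_linear_left[OF bounded_bilinear_matrix_mult] bounded_linear_adj])

lemma norm_sandwich_le:
  obtains T where "T > 0"
    "\<And>(A :: complex^'n^'n) (x :: complex^'n^'n) (B :: complex^'n^'n). norm (A ** x ** adj B) \<le> T * norm A * norm x * norm B"
proof -
  interpret mult: bounded_bilinear "(**) :: complex^'n^'n \<Rightarrow> complex^'n^'n \<Rightarrow> complex^'n^'n"
    by (rule bounded_bilinear_matrix_mult)
  interpret adj: bounded_linear "adj :: complex^'n^'n \<Rightarrow> complex^'n^'n"
    by (rule bounded_linear_adj)
  obtain K where K: "K > 0" "\<And>(A :: complex^'n^'n) (B :: complex^'n^'n). norm (A ** B) \<le> norm A * norm B * K"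
    using mult.pos_bounded by metis
  obtain K' where K': "K' > 0" "\<And>B :: complex^'n^'n. norm (adj B) \<le> norm B * K'"
    using adj.pos_bounded by blast
  show ?thesis
  proof (rule that[of "K * K * K'"])
    fix A x B :: "complex^'n^'n"
    have "norm (A ** x ** adj B) \<le> norm (A ** x) * norm (adj B) * K" by (rule K)
    also have "\<dots> \<le> (norm A * norm x * K) * (norm B * K') * K"
      using K(1) K'(1) by (intro mult_mono K(2) K'(2)) auto
    finally show "norm (A ** x ** adj B) \<le> K * K * K' * norm A * norm x * norm B" by (simp add: mult_ac)
  qed (use K K' in simp)
qed

text \<open>
  In this form the three terms match those of the expansion of \<open>U\<^sub>1\<^sub>0 x U\<^sub>1\<^sub>0\<^sup>\<dagger>\<close> and \<open>U\<^sub>0\<^sub>0 x U\<^sub>0\<^sub>0\<^sup>\<dagger>\<close>. That \<open>H\<close> is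
  hermitian turns \<open>\<i> H x + x (\<i> H)\<^sup>\<dagger>\<close> into a commutator.
\<close>
lemma generator_eq_sandwich:
  assumes "hermitian H"
  defines "K \<equiv> \<lambda>C. cscale \<i> H + (1/2) *\<^sub>R (C ** adj C)"
  shows "generator H C x = C ** x ** adj C - K C ** x ** adj (mat 1) - mat 1 ** x ** adj (K C)"
proof -
  interpret mult: bounded_bilinear "(**) :: op2 \<Rightarrow> op2 \<Rightarrow> op2"
    by (rule bounded_bilinear_matrix_mult)
  have adjK: "adj (K C) = - cscale \<i> H + (1/2) *\<^sub>R (C ** adj C)"
    using assms(1) by (simp add: K_def adj_add adj_scaleR adj_cscale adj_matrix_mult cscale_uminus hermitian_def)
  show ?thesis
    unfolding adjK unfolding K_def generator_def commutator_def anticommutator_def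
    by (simp add: mult.add_left mult.add_right mult.minus_right mult.diff_right mult.scaleR_left mult.scaleR_right
        cscale_mult_left cscale_mult_right cscale_diff scaleR_add_right)
qed

lemma linear_generator: "hermitian H \<Longrightarrow> linear (generator H C)"
  by (subst ext[OF generator_eq_sandwich]) (auto intro!: linear_compose_sub linear_sandwich linear_sandwich[of "mat 1", simplified]
      linear_sandwich[of _ "mat 1", simplified])

text \<open>
  With \<open>h = 1/n\<close>, write \<open>V\<^sub>0\<^sub>0 = 1 + D\<close>, \<open>D = -h K + o(h)\<close>, and \<open>V\<^sub>1\<^sub>0 = \<surd>h C + o(h)\<close>. The terms of order \<open>h\<close> form the
  generator. What remains is \<open>o(h)\<close>: the error of \<open>V\<^sub>0\<^sub>0\<close> against the identity, \<open>D x D\<^sup>\<dagger> = O(h\<^sup>2)\<close>, and the error of \<open>V\<^sub>1\<^sub>0\<close>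
  against \<open>\<surd>h C\<close> and against itself. Here \<open>\<epsilon>\<close> collects the bounds of these terms divided by \<open>h\<close>.
\<close>
lemma channel_expansion:
  fixes V :: "nat \<Rightarrow> 2 \<Rightarrow> 2 \<Rightarrow> op2"
  assumes H: "hermitian H"
    and V0: "(\<lambda>n. norm (V n 0 0 - (mat 1 - (1 / real n) *\<^sub>R
                (cscale \<i> H + (1/2) *\<^sub>R (C ** adj C))))) \<in> o(\<lambda>n. 1 / real n)"
    and V1: "(\<lambda>n. norm (V n 1 0 - (1 / sqrt (real n)) *\<^sub>R C)) \<in> o(\<lambda>n. 1 / real n)"
  obtains \<epsilon> where "\<epsilon> \<longlonglongrightarrow> 0" "\<And>n. \<epsilon> n \<ge> 0"
    "\<And>n x. n \<ge> 1 \<Longrightarrow> norm ((\<Sum>i\<in>UNIV. V n i 0 ** x ** adj (V n i 0)) - x -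
        (1 / real n) *\<^sub>R generator H C x) \<le> \<epsilon> n / real n * norm x"
proof -
  define K where "K = cscale \<i> H + (1/2) *\<^sub>R (C ** adj C)"
  define R0 where "R0 n = V n 0 0 - (mat 1 - (1 / real n) *\<^sub>R K)" for n
  define R1 where "R1 n = V n 1 0 - (1 / sqrt (real n)) *\<^sub>R C" for n
  define a0 where "a0 n = norm (R0 n) / (1 / real n)" for n
  define a1 where "a1 n = norm (R1 n) / (1 / real n)" for n
  have a: "a0 \<longlonglongrightarrow> 0" "a1 \<longlonglongrightarrow> 0"
    using smalloD_tendsto[OF V0] smalloD_tendsto[OF V1]
    by (simp_all add: a0_def[abs_def] a1_def[abs_def] R0_def R1_def K_def)
  obtain T where T: "T > 0" "\<And>(A :: op2) (x :: op2) (B :: op2). norm (A ** x ** adj B) \<le> T * norm A * norm x * norm B"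
    using norm_sandwich_le by blast
  define q where "q = norm (mat 1 :: op2)"
  define \<epsilon> where "\<epsilon> n = T * (2 * q * a0 n + (1 / real n) * (a0 n + norm K)\<^sup>2 +
      2 * sqrt (1 / real n) * norm C * a1 n + (1 / real n) * (a1 n)\<^sup>2)" for n
  have sqrt0: "(\<lambda>n. sqrt (1 / real n)) \<longlonglongrightarrow> 0"
    using tendsto_real_sqrt[OF lim_1_over_n] by simp
  have "\<epsilon> \<longlonglongrightarrow> 0"
    unfolding \<epsilon>_def by (rule tendsto_eq_intros a sqrt0 lim_1_over_n refl | simp)+
  moreover have "\<epsilon> n \<ge> 0" for n
    using T(1) by (simp add: \<epsilon>_def q_def a0_def a1_def)
  moreover have "norm ((\<Sum>i\<in>UNIV. V n i 0 ** x ** adj (V n i 0)) - x -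
        (1 / real n) *\<^sub>R generator H C x) \<le> \<epsilon> n / real n * norm x" if n: "n \<ge> 1" for n x
  proof -
    interpret S: bounded_bilinear "\<lambda>(A :: op2) (B :: op2). A ** x ** adj B" by (rule bounded_bilinear_sandwich)
    define S where "S A B = A ** x ** adj B" for A B :: op2
    note S_simps = S.add_left[folded S_def] S.add_right[folded S_def] S.diff_left[folded S_def]
      S.diff_right[folded S_def] S.scaleR_left[folded S_def] S.scaleR_right[folded S_def]
    define h where "h = 1 / real n"
    define D where "D = R0 n - h *\<^sub>R K"
    have h0: "h > 0" using n by (simp add: h_def)
    have r: "norm (R0 n) = h * a0 n" "norm (R1 n) = h * a1 n" using n by (auto simp: h_def a0_def a1_def)
    have V: "V n 0 0 = mat 1 + D" "V n 1 0 = sqrt h *\<^sub>R C + R1 n"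
      by (simp_all add: D_def R0_def R1_def h_def real_sqrt_divide)
    have x: "x = S (mat 1) (mat 1)" by (simp add: S_def)
    have V00: "S (V n 0 0) (V n 0 0) = x + S (mat 1) (R0 n) + S (R0 n) (mat 1) + S D D
        - h *\<^sub>R (S K (mat 1) + S (mat 1) K)"
    proof -
      have "S (V n 0 0) (V n 0 0) = x + S (mat 1) D + S D (mat 1) + S D D"
        unfolding V S_simps by (simp add: x)
      also have "S (mat 1) D = S (mat 1) (R0 n) - h *\<^sub>R S (mat 1) K" by (simp add: D_def S_simps)
      also have "S D (mat 1) = S (R0 n) (mat 1) - h *\<^sub>R S K (mat 1)" by (simp add: D_def S_simps)
      finally show ?thesis by (simp add: algebra_simps)
    qed
    have V10: "S (V n 1 0) (V n 1 0) = h *\<^sub>R S C C + sqrt h *\<^sub>R S C (R1 n) + sqrt h *\<^sub>R S (R1 n) C + S (R1 n) (R1 n)"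
      unfolding V S_simps using h0 by (simp add: algebra_simps)
    have gen: "generator H C x = S C C - S K (mat 1) - S (mat 1) K"
      by (simp only: generator_eq_sandwich[OF H] S_def K_def)
    have eq: "(\<Sum>i\<in>UNIV. V n i 0 ** x ** adj (V n i 0)) - x - h *\<^sub>R generator H C x =
        (S (mat 1) (R0 n) + S (R0 n) (mat 1)) + S D D + (sqrt h *\<^sub>R S C (R1 n) + sqrt h *\<^sub>R S (R1 n) C) + S (R1 n) (R1 n)"
      unfolding sum_bit S_def[symmetric] V00 V10 gen by (simp add: algebra_simps)
    have "norm ((a + b) + c + (d + e) + f) \<le> norm a + norm b + norm c + norm d + norm e + norm f"
      for a b c d e f :: op2 by norm
    hence "norm ((\<Sum>i\<in>UNIV. V n i 0 ** x ** adj (V n i 0)) - x - h *\<^sub>R generator H C x) \<le>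
        norm (S (mat 1) (R0 n)) + norm (S (R0 n) (mat 1)) + norm (S D D)
        + norm (sqrt h *\<^sub>R S C (R1 n)) + norm (sqrt h *\<^sub>R S (R1 n) C) + norm (S (R1 n) (R1 n))"
      unfolding eq .
    also have "\<dots> \<le> T * q * norm x * (h * a0 n) + T * (h * a0 n) * norm x * q
        + T * (h * (a0 n + norm K)) * norm x * (h * (a0 n + norm K))
        + sqrt h * (T * norm C * norm x * (h * a1 n)) + sqrt h * (T * (h * a1 n) * norm x * norm C)
        + T * (h * a1 n) * norm x * (h * a1 n)"
    proof (intro add_mono)
      have D: "norm D \<le> h * (a0 n + norm K)"
        using norm_triangle_ineq4[of "R0 n" "h *\<^sub>R K"] h0 by (simp add: D_def r distrib_left)
      have "norm (S D D) \<le> T * norm D * norm x * norm D" unfolding S_def by (rule T)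
      also have "\<dots> \<le> T * (h * (a0 n + norm K)) * norm x * (h * (a0 n + norm K))"
        using D T(1) h0 by (intro mult_mono mult_nonneg_nonneg) (auto simp: a0_def)
      finally show "norm (S D D) \<le> T * (h * (a0 n + norm K)) * norm x * (h * (a0 n + norm K))" .
      show "norm (sqrt h *\<^sub>R S C (R1 n)) \<le> sqrt h * (T * norm C * norm x * (h * a1 n))"
        using T(2)[of C x "R1 n"] h0 by (simp add: S_def r mult_left_mono)
      show "norm (sqrt h *\<^sub>R S (R1 n) C) \<le> sqrt h * (T * (h * a1 n) * norm x * norm C)"
        using T(2)[of "R1 n" x C] h0 by (simp add: S_def r mult_left_mono)
    qed (use T(2)[of "mat 1" x "R0 n"] T(2)[of "R0 n" x "mat 1"] T(2)[of "R1 n" x "R1 n"] in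
        \<open>simp_all add: S_def r q_def\<close>)
    also have "\<dots> = \<epsilon> n / real n * norm x"
    proof -
      have "T * q * X * (h * a) + T * (h * a) * X * q + T * (h * (a + k)) * X * (h * (a + k))
          + w * (T * c * X * (h * b)) + w * (T * (h * b) * X * c) + T * (h * b) * X * (h * b)
        = T * (2 * q * a + h * (a + k)\<^sup>2 + 2 * w * c * b + h * b\<^sup>2) * h * X" for X a b c k w :: real
        by algebra
      moreover have "\<epsilon> n / real n = \<epsilon> n * h" by (simp add: h_def)
      ultimately show ?thesis by (simp only: \<epsilon>_def h_def[symmetric])
    qed
    finally show ?thesis by (simp add: h_def)
  qed
  ultimately show ?thesis using that by blast
qed

section \<open>Convergence of the mean\<close>

text \<open>
  A uniform bound controls the essential supremum once the functions are known to be measurable, which is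
  where continuity of the limit enters.
\<close>
lemma converges_Linfty_floorI:
  assumes \<phi>: "continuous_on {0..1} \<phi>" and \<theta>: "\<theta> \<longlonglongrightarrow> 0"
    and le: "\<And>n t. n \<ge> 1 \<Longrightarrow> t \<in> {0..1} \<Longrightarrow> norm (m n (nat \<lfloor>real n * t\<rfloor>) - \<phi> t) \<le> \<theta> n"
  shows "converges_Linfty (\<lambda>n t. m n (nat \<lfloor>real n * t\<rfloor>)) (\<phi> :: real \<Rightarrow> 'a::euclidean_space)"
proof -
  let ?L = "lebesgue_on {0..1::real}"
  have \<phi>_meas [measurable]: "\<phi> \<in> borel_measurable ?L"
    using \<phi> by (rule continuous_imp_measurable_on_sets_lebesgue) simp
  have floor_meas: "(\<lambda>t. m n (nat \<lfloor>real n * t\<rfloor>)) \<in> borel_measurable ?L" for n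
  proof -
    have "(\<lambda>t. m n (nat \<lfloor>real n * t\<rfloor>)) \<in> borel_measurable lborel"
      by measurable
    thus ?thesis by (intro measurable_restrict_space1 measurable_completion)
  qed
  have meas: "(\<lambda>t. ereal (norm (m n (nat \<lfloor>real n * t\<rfloor>) - \<phi> t))) \<in> borel_measurable ?L" for n
    using floor_meas[of n] by measurable
  have upper: "esssup ?L (\<lambda>t. ereal (norm (m n (nat \<lfloor>real n * t\<rfloor>) - \<phi> t))) \<le> ereal (\<theta> n)" if "n \<ge> 1" for n
    using le[OF that] by (intro esssup_I meas AE_I2) auto
  have lower: "0 \<le> esssup ?L (\<lambda>t. ereal (norm (m n (nat \<lfloor>real n * t\<rfloor>) - \<phi> t)))" for n
  proof -
    have "emeasure ?L (space ?L) \<noteq> 0" by (simp add: emeasure_restrict_space)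
    hence "0 = esssup ?L (\<lambda>_. 0)" by (simp add: esssup_const)
    also have "\<dots> \<le> esssup ?L (\<lambda>t. ereal (norm (m n (nat \<lfloor>real n * t\<rfloor>) - \<phi> t)))"
      by (rule esssup_mono) auto
    finally show ?thesis .
  qed
  have "(\<lambda>n. ereal (\<theta> n)) \<longlonglongrightarrow> 0" using \<theta> by (simp add: zero_ereal_def)
  show ?thesis unfolding converges_Linfty_def
  proof (rule tendsto_sandwich[OF _ _ tendsto_const \<open>(\<lambda>n. ereal (\<theta> n)) \<longlonglongrightarrow> 0\<close>])
    show "\<forall>\<^sub>F n in sequentially. esssup ?L (\<lambda>t. ereal (norm (m n (nat \<lfloor>real n * t\<rfloor>) - \<phi> t))) \<le> ereal (\<theta> n)"
      using eventually_ge_at_top[of 1] by eventually_elim (rule upper)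
  qed (simp add: lower)
qed

theorem theorem3p3:
  fixes e :: "2 \<Rightarrow> complex^2"
    and A :: op2 and l :: "2 \<Rightarrow> real" and P :: "2 \<Rightarrow> op2"
    and H0 Cp Cm :: op2
    and Up Um :: "nat \<Rightarrow> 2 \<Rightarrow> 2 \<Rightarrow> op2"
    and \<rho>0 :: op2
    and M :: "nat \<Rightarrow> 'w measure"
    and \<rho> :: "nat \<Rightarrow> nat \<Rightarrow> 'w \<Rightarrow> op2"
  assumes basis: "orthonormal_basis e"
    and selfadjoint: "hermitian A"
    and spectral: "A = l 0 *\<^sub>R P 0 + l 1 *\<^sub>R P 1" "l 0 \<noteq> l 1"
    and projectors: "\<And>j. rank_one_projector (P j)" "P 0 + P 1 = mat 1"
    and non_diagonal: "\<not> eigenbasis A e"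
    and hamiltonian: "hermitian H0"
    and unitary_p: "\<And>n. n \<ge> 1 \<Longrightarrow> unitary (from_blocks e (Up n))"
    and unitary_m: "\<And>n. n \<ge> 1 \<Longrightarrow> unitary (from_blocks e (Um n))"
    and Up_00: "(\<lambda>n. norm (Up n 0 0 - (mat 1 - (1 / real n) *\<^sub>R
                  (cscale \<i> H0 + (1/2) *\<^sub>R (Cp ** adj Cp))))) \<in> o(\<lambda>n. 1 / real n)"
    and Up_10: "(\<lambda>n. norm (Up n 1 0 - (1 / sqrt (real n)) *\<^sub>R Cp)) \<in> o(\<lambda>n. 1 / real n)"
    and Um_00: "(\<lambda>n. norm (Um n 0 0 - (mat 1 - (1 / real n) *\<^sub>R
                  (cscale \<i> H0 + (1/2) *\<^sub>R (Cm ** adj Cm))))) \<in> o(\<lambda>n. 1 / real n)"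
    and Um_10: "(\<lambda>n. norm (Um n 1 0 - (1 / sqrt (real n)) *\<^sub>R Cm)) \<in> o(\<lambda>n. 1 / real n)"
    and initial: "density_matrix \<rho>0"
    and trajectory: "\<And>n. n \<ge> 1 \<Longrightarrow>
          quantum_trajectory (M n)
            (\<lambda>k. from_blocks e (if even k then Up n else Um n))
            (outer (e 0) (e 0)) P \<rho>0 (\<rho> n)"
  shows "\<exists>\<phi>. ode_solution (\<lambda>x. (1/2) *\<^sub>R (generator H0 Cp x + generator H0 Cm x)) \<rho>0 \<phi> \<and>
             (\<forall>\<psi>. ode_solution (\<lambda>x. (1/2) *\<^sub>R (generator H0 Cp x + generator H0 Cm x)) \<rho>0 \<psi>
                    \<longrightarrow> (\<forall>t\<in>{0..1}. \<psi> t = \<phi> t)) \<and>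
             converges_Linfty (\<lambda>n t. \<integral>w. \<rho> n (nat \<lfloor>real n * t\<rfloor>) w \<partial>M n) \<phi>"
proof -
  let ?F = "\<lambda>x. (1/2) *\<^sub>R (generator H0 Cp x + generator H0 Cm x)"
  have lin: "linear (generator H0 Cp)" "linear (generator H0 Cm)" "linear ?F"
    using linear_generator[OF hamiltonian]
    by (auto intro!: linear_compose_scale_right linear_compose_add)
  obtain \<phi> where \<phi>: "\<phi> 0 = \<rho>0" "\<And>t. (\<phi> has_vector_derivative ?F (\<phi> t)) (at t)"
    using linear_ode_solution_exists[OF lin(3)] by blast
  have sol: "ode_solution ?F \<rho>0 \<phi>"
    using \<phi> by (auto simp: ode_solution_def intro: has_vector_derivative_at_within)
  have cont: "continuous_on {0..1} \<phi>"
    by (rule continuous_on_vector_derivative) (rule has_vector_derivative_at_within[OF \<phi>(2)])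

  have P: "hermitian (P j)" "P j ** P j = P j" for j
    using projectors(1)[of j] by (auto simp: rank_one_projector_def)
  define B where "B n k = (if even k then Up n else Um n)" for n k :: nat
  have chain: "indirect_measurement_chain e P (B n) (M n) (\<rho> n) \<rho>0" if n: "n \<ge> 1" for n
  proof (rule indirect_measurement_chain.intro)
    show "indirect_measurement e P (B n k)" for k
      using n basis P projectors(2) unitary_p unitary_m by unfold_locales (auto simp: B_def)
    show "quantum_trajectory (M n) (\<lambda>k. from_blocks e (B n k)) (outer (e 0) (e 0)) P \<rho>0 (\<rho> n)"
      using trajectory[OF n] by (simp add: B_def)
  qed (rule initial)
  define m where "m n k = (\<integral>w. \<rho> n k w \<partial>M n)" for n k

  obtain \<epsilon>p where \<epsilon>p: "\<epsilon>p \<longlonglongrightarrow> 0" "\<And>n. \<epsilon>p n \<ge> 0"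
    "\<And>n x. n \<ge> 1 \<Longrightarrow> norm ((\<Sum>i\<in>UNIV. Up n i 0 ** x ** adj (Up n i 0)) - x -
        (1 / real n) *\<^sub>R generator H0 Cp x) \<le> \<epsilon>p n / real n * norm x"
    using channel_expansion[where V = Up and C = Cp and H = H0, OF hamiltonian Up_00 Up_10] by blast
  obtain \<epsilon>m where \<epsilon>m: "\<epsilon>m \<longlonglongrightarrow> 0" "\<And>n. \<epsilon>m n \<ge> 0"
    "\<And>n x. n \<ge> 1 \<Longrightarrow> norm ((\<Sum>i\<in>UNIV. Um n i 0 ** x ** adj (Um n i 0)) - x -
        (1 / real n) *\<^sub>R generator H0 Cm x) \<le> \<epsilon>m n / real n * norm x"
    using channel_expansion[where V = Um and C = Cm and H = H0, OF hamiltonian Um_00 Um_10] by blast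
  have m_le: "norm (m n k) \<le> 4" if "n \<ge> 1" for n k
    unfolding m_def by (rule indirect_measurement_chain.norm_expectation_le[OF chain[OF that]])
  have m_0: "m n 0 = \<phi> 0" if "n \<ge> 1" for n
    unfolding m_def \<phi>(1) by (rule indirect_measurement_chain.expectation_0[OF chain[OF that]])
  have m_step: "norm (m n (Suc k) - m n k - (1 / real n) *\<^sub>R
      (if even (Suc k) then generator H0 Cp else generator H0 Cm) (m n k)) \<le> 4 * (\<epsilon>p n + \<epsilon>m n) / real n"
    if n: "n \<ge> 1" for n k
  proof -
    have "m n (Suc k) = (\<Sum>i\<in>UNIV. B n (Suc k) i 0 ** m n k ** adj (B n (Suc k) i 0))"
      unfolding m_def by (rule indirect_measurement_chain.expectation_step[OF chain[OF n]])
    hence "norm (m n (Suc k) - m n k - (1 / real n) *\<^sub>R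
        (if even (Suc k) then generator H0 Cp else generator H0 Cm) (m n k))
        \<le> (if even (Suc k) then \<epsilon>p n else \<epsilon>m n) / real n * norm (m n k)"
      using \<epsilon>p(3)[OF n, of "m n k"] \<epsilon>m(3)[OF n, of "m n k"] unfolding B_def by (cases "even (Suc k)") simp_all
    also have "\<dots> \<le> (\<epsilon>p n + \<epsilon>m n) / real n * 4"
      using \<epsilon>p(2)[of n] \<epsilon>m(2)[of n] m_le[OF n, of k] by (intro mult_mono divide_right_mono) auto
    finally show ?thesis by (simp add: mult.commute)
  qed
  have \<epsilon>: "(\<lambda>n. 4 * (\<epsilon>p n + \<epsilon>m n)) \<longlonglongrightarrow> 0"
    by (rule tendsto_eq_intros \<epsilon>p(1) \<epsilon>m(1) refl | simp)+
  obtain \<theta> where \<theta>: "\<theta> \<longlonglongrightarrow> 0"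
    "\<And>n t. n \<ge> 1 \<Longrightarrow> t \<in> {0..1} \<Longrightarrow> norm (m n (nat \<lfloor>real n * t\<rfloor>) - \<phi> t) \<le> \<theta> n"
    using alternating_euler_scheme_converges[OF lin(1,2) \<phi>(2), where m = m and B = 4,
        OF m_0 m_step m_le \<epsilon>] by blast
  have "converges_Linfty (\<lambda>n t. \<integral>w. \<rho> n (nat \<lfloor>real n * t\<rfloor>) w \<partial>M n) \<phi>"
    using converges_Linfty_floorI[OF cont \<theta>] by (simp only: m_def)
  thus ?thesis using sol linear_ode_solution_unique[OF lin(3) sol] by blast
qed

end
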